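(* Let $n,m\in\mathbb{N}$ and suppose: (A1) $X_1,\ldots,X_n,Y_1,\ldots,Y_m$ are GTAI; $\Theta_1,\ldots,\Theta_n,\Delta_1,\ldots,\Delta_m$ are non-negative, non-degenerate at zero, arbitrarily dependent random variables with distributions whose supports are bounded from above, and $(\Theta_1,\ldots,\Theta_n,\Delta_1,\ldots,\Delta_m)$ is independent of $(X_1,\ldots,X_n,Y_1,\ldots,Y_m)$; (A2) $X_i$ has distribution $F_i\in\mathcal{D}\cap\mathcal{L}$ and $Y_j$ has distribution $G_j\in\mathcal{D}\cap\mathcal{L}$ for all $i,j$; for each $i\le n\wedge m$ the pair $(X_i,Y_i)$ is SAI with some constant $C_i>0$; and $X_i,Y_j$ are independent whenever $i\neq j$. Put $X_n(\Theta)=\sum_{i=1}^n\Theta_iX_i$ and $Y_m(\Delta)=\sum_{j=1}^m\Delta_jY_j$. Then $$\mathbb{P}(X_n(\Theta)>x,\;Y_m(\Delta)>y)\sim\sum_{i=1}^n\sum_{j=1}^m\mathbb{P}(\Theta_iX_i>x,\;\Delta_jY_j>y),\qquad x\wedge y\to\infty.$$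
   Context: All distributions have infinite right endpoint: $\overline V(x)=1-V(x)>0$ for all $x$. $V\in\mathcal{D}$ if $\limsup_{x\to\infty}\overline V(tx)/\overline V(x)<\infty$ for some (equivalently all) $t\in(0,1)$; $V\in\mathcal{L}$ if $\lim_{x\to\infty}\overline V(x-a)/\overline V(x)=1$ for all $a>0$. SAI: real random variables $X,Y$ with distributions $F,G$ are SAI with constant $C>0$ if, as $x\wedge y\to\infty$, $\mathbb{P}(X^->x,Y>y)=O(F(-x)\overline G(y))$, $\mathbb{P}(X>x,Y^->y)=O(\overline F(x)G(-y))$ and $\mathbb{P}(X>x,Y>y)\sim C\,\overline F(x)\overline G(y)$, where $z^-=\max\{-z,0\}$. GTAI: real random variables $X_1,\ldots,X_n,Y_1,\ldots,Y_m$ with supports unbounded above are GTAI if $\lim_{x_i\wedge x_k\wedge y_j\to\infty}\mathbb{P}(|X_i|>x_i\mid X_k>x_k,Y_j>y_j)=0$ for all $1\le i\neq k\le n$, $1\le j\le m$, and $\lim_{x_i\wedge y_j\wedge y_k\to\infty}\mathbb{P}(|Y_j|>y_j\mid X_i>x_i,Y_k>y_k)=0$ for all $1\le j\neq k\le m$, $1\le i\le n$. $f\sim g$ as $x\wedge y\to\infty$ means $f(x,y)/g(x,y)\to1$ as $\min\{x,y\}\to\infty$. *)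

theory Defs
  imports "HOL-Probability.Probability" "HOL-Library.Landau_Symbols"
begin

definition tailp :: "'a measure \<Rightarrow> ('a \<Rightarrow> real) \<Rightarrow> real \<Rightarrow> real" where
  "tailp M X x = measure M {\<omega> \<in> space M. X \<omega> > x}"

definition cdfp :: "'a measure \<Rightarrow> ('a \<Rightarrow> real) \<Rightarrow> real \<Rightarrow> real" where
  "cdfp M X x = measure M {\<omega> \<in> space M. X \<omega> \<le> x}"

definition classD :: "(real \<Rightarrow> real) \<Rightarrow> bool" where
  "classD Vbar \<longleftrightarrow> (\<exists>t\<in>{0<..<1}.
      Limsup at_top (\<lambda>x. ereal (Vbar (t * x) / Vbar x)) < \<infinity>)"

definition classL :: "(real \<Rightarrow> real) \<Rightarrow> bool" where
  "classL Vbar \<longleftrightarrow> (\<forall>a>0. ((\<lambda>x. Vbar (x - a) / Vbar x) \<longlongrightarrow> 1) at_top)"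

definition cprob :: "'a measure \<Rightarrow> ('a \<Rightarrow> bool) \<Rightarrow> ('a \<Rightarrow> bool) \<Rightarrow> real" where
  "cprob M A B = measure M {\<omega> \<in> space M. A \<omega> \<and> B \<omega>} / measure M {\<omega> \<in> space M. B \<omega>}"

text \<open>SAI with constant C; the limit x \<and> y \<rightarrow> \<infinity> is the product filter at_top \<times> at_top.\<close>
definition SAI :: "'a measure \<Rightarrow> ('a \<Rightarrow> real) \<Rightarrow> ('a \<Rightarrow> real) \<Rightarrow> real \<Rightarrow> bool" where
  "SAI M X Y C \<longleftrightarrow> C > 0 \<and>
    (\<lambda>(x, y). measure M {\<omega> \<in> space M. max (- X \<omega>) 0 > x \<and> Y \<omega> > y})
      \<in> O[(at_top \<times>\<^sub>F at_top)](\<lambda>(x, y). cdfp M X (- x) * tailp M Y y) \<and>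
    (\<lambda>(x, y). measure M {\<omega> \<in> space M. X \<omega> > x \<and> max (- Y \<omega>) 0 > y})
      \<in> O[(at_top \<times>\<^sub>F at_top)](\<lambda>(x, y). tailp M X x * cdfp M Y (- y)) \<and>
    (\<lambda>(x, y). measure M {\<omega> \<in> space M. X \<omega> > x \<and> Y \<omega> > y})
      \<sim>[(at_top \<times>\<^sub>F at_top)] (\<lambda>(x, y). C * tailp M X x * tailp M Y y)"

text \<open>GTAI for X_1..X_n, Y_1..Y_m (indices from 1), including unbounded supports above.\<close>
definition GTAI :: "'a measure \<Rightarrow> nat \<Rightarrow> nat \<Rightarrow> (nat \<Rightarrow> 'a \<Rightarrow> real) \<Rightarrow> (nat \<Rightarrow> 'a \<Rightarrow> real) \<Rightarrow> bool" where
  "GTAI M n m X Y \<longleftrightarrow>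
    (\<forall>i\<in>{1..n}. \<forall>x. tailp M (X i) x > 0) \<and>
    (\<forall>j\<in>{1..m}. \<forall>y. tailp M (Y j) y > 0) \<and>
    (\<forall>i\<in>{1..n}. \<forall>k\<in>{1..n}. \<forall>j\<in>{1..m}. i \<noteq> k \<longrightarrow>
       ((\<lambda>(xi, xk, yj). cprob M (\<lambda>\<omega>. \<bar>X i \<omega>\<bar> > xi) (\<lambda>\<omega>. X k \<omega> > xk \<and> Y j \<omega> > yj))
         \<longlongrightarrow> 0) (at_top \<times>\<^sub>F at_top \<times>\<^sub>F at_top)) \<and>
    (\<forall>j\<in>{1..m}. \<forall>k\<in>{1..m}. \<forall>i\<in>{1..n}. j \<noteq> k \<longrightarrow>
       ((\<lambda>(yj, xi, yk). cprob M (\<lambda>\<omega>. \<bar>Y j \<omega>\<bar> > yj) (\<lambda>\<omega>. X i \<omega> > xi \<and> Y k \<omega> > yk))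
         \<longlongrightarrow> 0) (at_top \<times>\<^sub>F at_top \<times>\<^sub>F at_top))"

end

theory Submission
  imports Defs
begin

text \<open>
  Class \<open>D\<close> and class \<open>L\<close> make the joint tail \<open>H(x, y) = P(X\<^sub>k > x, Y\<^sub>l > y)\<close> insensitive to
  scaling up to a constant, \<open>H(c x, c y) = O(H(x, y))\<close>, and to shifts,
  \<open>H(x - a, y - a) \<sim> H(x, y)\<close>; GTAI makes a large third term negligible against \<open>H\<close>. The last two
  properties survive bounded independent weights. Conditionally on weights above some \<open>s > 0\<close>, a
  shift by \<open>a\<close> becomes one by at most \<open>a / s\<close>; positive weights below \<open>s\<close> have small probability,
  and their contribution is absorbed because bounded weights force \<open>X\<^sub>k\<close>, \<open>Y\<^sub>l\<close> above multiples of
  \<open>x\<close>, \<open>y\<close>, an event comparable to the weighted one. If the two weights are almost surely not both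
  positive, the weighted tail vanishes.

  For the sums, fix \<open>c > 0\<close> with \<open>c\<close> times the number of terms at most one. If both sums exceed
  \<open>x\<close> and \<open>y\<close>, some pair of terms exceeds \<open>c x\<close> and \<open>c y\<close>, and either it exceeds \<open>x - a\<close> and
  \<open>y - a\<close> or a third term exceeds \<open>c a\<close> in absolute value. Conversely, the events that a pair
  exceeds \<open>x + a\<close> and \<open>y + a\<close> while all other terms are at most \<open>c a\<close> are disjoint and make both
  sums large. The third term is negligible for large \<open>a\<close>, and for fixed \<open>a\<close> the shift by
  \<open>\<plusminus>a\<close> is negligible as \<open>x\<close> and \<open>y\<close> tend to infinity.
\<close>

subsection \<open>Limits in several variables\<close>

lemma eventually_prod_at_top_linorder:
  fixes P :: "'a::linorder \<times> 'a \<Rightarrow> bool"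
  shows "eventually P (at_top \<times>\<^sub>F at_top) \<longleftrightarrow> (\<exists>N. \<forall>x\<ge>N. \<forall>y\<ge>N. P (x, y))"
  unfolding eventually_prod_same eventually_at_top_linorder by blast

lemma eventually_ge_prod_at_top:
  fixes q :: "'a::linorder \<times> 'a"
  shows "\<forall>\<^sub>F p in at_top \<times>\<^sub>F at_top. q \<le> p"
  unfolding eventually_prod_at_top_linorder
  by (rule exI[of _ "max (fst q) (snd q)"]) (simp add: less_eq_prod_def)

lemma eventually_prod_at_top_divide:
  fixes b :: real
  assumes eventually_P: "eventually P (at_top \<times>\<^sub>F at_top)" and b_pos: "0 < b"
  shows "\<forall>\<^sub>F p in at_top \<times>\<^sub>F at_top. \<forall>t\<in>{0<..b}. \<forall>d\<in>{0<..b}. P (fst p / t, snd p / d)"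
proof -
  obtain N where P_above_N: "\<And>x y. N \<le> x \<Longrightarrow> N \<le> y \<Longrightarrow> P (x, y)"
    using eventually_P unfolding eventually_prod_at_top_linorder by blast
  have N_le_divide: "N \<le> z / t" if "max 0 (N * b) \<le> z" "t \<in> {0<..b}" for z t
  proof -
    have "N \<le> z / b" using that b_pos by (simp add: pos_le_divide_eq)
    also have "\<dots> \<le> z / t" using that by (intro divide_left_mono) auto
    finally show ?thesis .
  qed
  show ?thesis
    unfolding eventually_prod_at_top_linorder
    by (rule exI[of _ "max 0 (N * b)"]) (use P_above_N N_le_divide in auto)
qed

lemma filterlim_scaleR_at_top_real:
  fixes c :: real
  assumes "0 < c"
  shows "filterlim (scaleR c) at_top (at_top :: real filter)"
  unfolding real_scaleR_def
  by (rule filterlim_tendsto_pos_mult_at_top[OF tendsto_const assms filterlim_ident])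

lemma filterlim_scaleR_prod_filter:
  assumes "filterlim (scaleR c) F F" "filterlim (scaleR c) G G"
  shows "filterlim (scaleR c) (F \<times>\<^sub>F G) (F \<times>\<^sub>F G)"
  unfolding scaleR_prod_def[abs_def]
  by (intro filterlim_Pair filterlim_compose[OF assms(1)] filterlim_compose[OF assms(2)]
      filterlim_fst filterlim_snd)

lemma filterlim_scaleR_prod_at_top:
  fixes c :: real
  assumes "0 < c"
  shows "filterlim (scaleR c) (at_top \<times>\<^sub>F at_top) (at_top \<times>\<^sub>F at_top :: (real \<times> real) filter)"
  by (intro filterlim_scaleR_prod_filter filterlim_scaleR_at_top_real assms)

lemma filterlim_diff_prod_at_top:
  fixes q :: "real \<times> real"
  shows "filterlim (\<lambda>p. p - q) (at_top \<times>\<^sub>F at_top) (at_top \<times>\<^sub>F at_top)"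
proof -
  have "filterlim (\<lambda>p. f p - a) at_top F"
    if "filterlim f at_top F" for f :: "real \<times> real \<Rightarrow> real" and a F
    using filterlim_tendsto_add_at_top[OF tendsto_const[of "- a"] that] by simp
  from this[OF filterlim_fst] this[OF filterlim_snd] show ?thesis
    unfolding minus_prod_def by (intro filterlim_Pair)
qed

lemma asymp_equiv_iff_eventually_bounds:
  fixes f g :: "'a \<Rightarrow> real"
  assumes "\<And>x. 0 \<le> g x"
  shows "f \<sim>[F] g \<longleftrightarrow> (\<forall>e>0. \<forall>\<^sub>F x in F. (1 - e) * g x \<le> f x \<and> f x \<le> (1 + e) * g x)"
proof -
  have "(\<bar>f x - g x\<bar> \<le> e * \<bar>g x\<bar>) = ((1 - e) * g x \<le> f x \<and> f x \<le> (1 + e) * g x)" for e x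
    using assms[of x] by (auto simp: abs_le_iff algebra_simps)
  then show ?thesis
    by (simp add: asymp_equiv_altdef smallo_def)
qed

subsection \<open>The classes D and L\<close>

lemma classD_imp_bigo:
  assumes classD: "classD V" and antimono: "antimono V" and pos: "\<And>x. 0 < V x" and c_pos: "0 < c"
  shows "(\<lambda>x. V (c * x)) \<in> O[at_top](V)"
proof -
  obtain t where t_bounds: "0 < t" "t < 1"
    and limsup_finite: "Limsup at_top (\<lambda>x. ereal (V (t * x) / V x)) < \<infinity>"
    using classD by (auto simp: classD_def)
  obtain B where "Limsup at_top (\<lambda>x. ereal (V (t * x) / V x)) < ereal B"
    using limsup_finite by (metis ereal_dense2)
  then have "\<forall>\<^sub>F x in at_top. V (t * x) / V x < B"
    by (auto dest: Limsup_lessD)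
  then have "\<forall>\<^sub>F x in at_top. norm (V (t * x)) \<le> B * norm (V x)"
    by eventually_elim (use pos in \<open>simp add: pos_divide_less_eq less_imp_le\<close>)
  then have bigo_step: "(\<lambda>x. V (t * x)) \<in> O[at_top](V)"
    by (rule bigoI)
  have bigo_power: "(\<lambda>x. V (t ^ k * x)) \<in> O[at_top](V)" for k
  proof (induction k)
    case (Suc k)
    have "filterlim (\<lambda>x. t ^ k * x) at_top at_top"
      using t_bounds filterlim_scaleR_at_top_real[of "t ^ k"]
      by (simp add: real_scaleR_def[abs_def])
    from landau_o.big.compose[OF bigo_step this] Suc show ?case
      by (simp add: mult.assoc landau_o.big_trans)
  qed simp
  obtain k where power_less: "t ^ k < c"
    using real_arch_pow_inv[OF c_pos t_bounds(2)] by blast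
  have "\<forall>\<^sub>F x in at_top. norm (V (c * x)) \<le> 1 * norm (V (t ^ k * x))"
    using eventually_ge_at_top[of 0]
  proof eventually_elim
    case (elim x)
    have "V (c * x) \<le> V (t ^ k * x)"
      using elim power_less by (intro antimonoD[OF antimono] mult_right_mono) auto
    then show ?case
      using pos by (simp add: less_imp_le)
  qed
  then show ?thesis
    by (rule landau_o.big_trans[OF bigoI bigo_power])
qed

lemma classL_imp_asymp_equiv:
  assumes "classL V" "0 < a"
  shows "(\<lambda>x. V (x - a)) \<sim>[at_top] V"
  using assms by (intro asymp_equivI') (simp add: classL_def)

definition joint_classD :: "(real \<times> real \<Rightarrow> real) \<Rightarrow> bool" where
  "joint_classD H \<longleftrightarrow> (\<forall>c>0. (\<lambda>p. H (c *\<^sub>R p)) \<in> O[at_top \<times>\<^sub>F at_top](H))"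

definition joint_classL :: "(real \<times> real \<Rightarrow> real) \<Rightarrow> bool" where
  "joint_classL H \<longleftrightarrow> (\<forall>a>0. (\<lambda>p. H (p - (a, a))) \<sim>[at_top \<times>\<^sub>F at_top] H)"

lemma joint_classD_scaleR_bigo:
  assumes "joint_classD H" "0 < c" "0 < d"
  shows "(\<lambda>p. H (c *\<^sub>R p)) \<in> O[at_top \<times>\<^sub>F at_top](\<lambda>p. H (d *\<^sub>R p))"
proof -
  have "(\<lambda>p. H ((c / d) *\<^sub>R p)) \<in> O[at_top \<times>\<^sub>F at_top](H)"
    using assms by (simp add: joint_classD_def)
  from landau_o.big.compose[OF this filterlim_scaleR_prod_at_top[OF assms(3)]] show ?thesis
    using assms(3) by simp
qed

lemma joint_classL_plus:
  assumes "joint_classL H" "0 < a"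
  shows "(\<lambda>p. H (p + (a, a))) \<sim>[at_top \<times>\<^sub>F at_top] H"
proof -
  have "(\<lambda>p. H (p - (a, a))) \<sim>[at_top \<times>\<^sub>F at_top] H"
    using assms by (simp add: joint_classL_def)
  from asymp_equiv_compose'[OF this filterlim_diff_prod_at_top[of "- (a, a)"]] show ?thesis
    by (simp only: diff_minus_eq_add add_diff_cancel_right' asymp_equiv_sym)
qed

lemma joint_classL_imp_eventually_bounds:
  assumes L: "joint_classL H" and nonneg: "\<And>p. 0 \<le> H p" and a_pos: "0 < a" and e_pos: "0 < e"
  shows "\<forall>\<^sub>F p in at_top \<times>\<^sub>F at_top. H (p - (a, a)) \<le> (1 + e) * H p"
    and "\<forall>\<^sub>F p in at_top \<times>\<^sub>F at_top. (1 - e) * H p \<le> H (p + (a, a))"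
  using L a_pos e_pos joint_classL_plus[OF L a_pos]
  by (auto simp: joint_classL_def asymp_equiv_iff_eventually_bounds nonneg eventually_conj_iff)

lemma joint_classD_times:
  assumes F: "classD F" "antimono F" "\<And>x. 0 < F x" and G: "classD G" "antimono G" "\<And>y. 0 < G y"
  shows "joint_classD (\<lambda>p. C * F (fst p) * G (snd p))"
  unfolding joint_classD_def
proof (intro allI impI)
  fix c :: real assume c_pos: "0 < c"
  show "(\<lambda>p. C * F (fst (c *\<^sub>R p)) * G (snd (c *\<^sub>R p)))
      \<in> O[at_top \<times>\<^sub>F at_top](\<lambda>p. C * F (fst p) * G (snd p))"
    using landau_o.big.compose[OF classD_imp_bigo[OF F c_pos] filterlim_fst]
      landau_o.big.compose[OF classD_imp_bigo[OF G c_pos] filterlim_snd]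
    by (simp only: fst_scaleR snd_scaleR real_scaleR_def)
      (intro landau_o.big.mult landau_o.big_refl)
qed

lemma joint_classL_times:
  assumes "classL F" "classL G"
  shows "joint_classL (\<lambda>p. C * F (fst p) * G (snd p))"
  unfolding joint_classL_def
proof (intro allI impI)
  fix a :: real assume a_pos: "0 < a"
  show "(\<lambda>p. C * F (fst (p - (a, a))) * G (snd (p - (a, a))))
      \<sim>[at_top \<times>\<^sub>F at_top] (\<lambda>p. C * F (fst p) * G (snd p))"
    using asymp_equiv_compose'[OF classL_imp_asymp_equiv[OF assms(1) a_pos] filterlim_fst]
      asymp_equiv_compose'[OF classL_imp_asymp_equiv[OF assms(2) a_pos] filterlim_snd]
    by (simp only: fst_diff snd_diff fst_conv snd_conv) (intro asymp_equiv_mult asymp_equiv_refl)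
qed

lemma joint_classD_asymp_equiv:
  assumes asymp: "H \<sim>[at_top \<times>\<^sub>F at_top] K" and classD: "joint_classD K"
  shows "joint_classD H"
  unfolding joint_classD_def
proof (intro allI impI)
  fix c :: real assume c_pos: "0 < c"
  have "(\<lambda>p. H (c *\<^sub>R p)) \<in> O[at_top \<times>\<^sub>F at_top](\<lambda>p. K (c *\<^sub>R p))"
    by (intro asymp_equiv_imp_bigo
        asymp_equiv_compose'[OF asymp filterlim_scaleR_prod_at_top[OF c_pos]])
  also have "(\<lambda>p. K (c *\<^sub>R p)) \<in> O[at_top \<times>\<^sub>F at_top](K)"
    using classD c_pos by (simp add: joint_classD_def)
  also have "K \<in> O[at_top \<times>\<^sub>F at_top](H)"
    using asymp by (intro asymp_equiv_imp_bigo) (simp add: asymp_equiv_sym)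
  finally show "(\<lambda>p. H (c *\<^sub>R p)) \<in> O[at_top \<times>\<^sub>F at_top](H)" .
qed

lemma joint_classL_asymp_equiv:
  assumes asymp: "H \<sim>[at_top \<times>\<^sub>F at_top] K" and classL: "joint_classL K"
  shows "joint_classL H"
  unfolding joint_classL_def
proof (intro allI impI)
  fix a :: real assume a_pos: "0 < a"
  have "(\<lambda>p. H (p - (a, a))) \<sim>[at_top \<times>\<^sub>F at_top] (\<lambda>p. K (p - (a, a)))"
    by (rule asymp_equiv_compose'[OF asymp filterlim_diff_prod_at_top])
  also have "(\<lambda>p. K (p - (a, a))) \<sim>[at_top \<times>\<^sub>F at_top] K"
    using classL a_pos by (simp add: joint_classL_def)
  also have "K \<sim>[at_top \<times>\<^sub>F at_top] H"
    using asymp by (rule asymp_equiv_symI)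
  finally show "(\<lambda>p. H (p - (a, a))) \<sim>[at_top \<times>\<^sub>F at_top] H" .
qed

subsection \<open>Joint tails\<close>

definition exceedance :: "'a measure \<Rightarrow> ('a \<Rightarrow> real) \<Rightarrow> ('a \<Rightarrow> real) \<Rightarrow> real \<times> real \<Rightarrow> 'a set" where
  "exceedance M X Y = (\<lambda>(x, y). {\<omega>\<in>space M. X \<omega> > x \<and> Y \<omega> > y})"

definition joint_tailp ::
  "'a measure \<Rightarrow> ('a \<Rightarrow> real) \<Rightarrow> ('a \<Rightarrow> real) \<Rightarrow> real \<times> real \<Rightarrow> real" where
  "joint_tailp M X Y p = measure M (exceedance M X Y p)"

definition joint_abs_tailp ::
  "'a measure \<Rightarrow> ('a \<Rightarrow> real) \<Rightarrow> ('a \<Rightarrow> real) \<Rightarrow> ('a \<Rightarrow> real) \<Rightarrow> real \<times> real \<times> real \<Rightarrow> real" where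
  "joint_abs_tailp M Z X Y q = measure M {\<omega>\<in>exceedance M X Y (snd q). \<bar>Z \<omega>\<bar> > fst q}"

definition tail_negligible ::
  "'a measure \<Rightarrow> ('a \<Rightarrow> real) \<Rightarrow> ('a \<Rightarrow> real) \<Rightarrow> ('a \<Rightarrow> real) \<Rightarrow> bool" where
  "tail_negligible M Z X Y \<longleftrightarrow> (\<forall>c>0. (\<lambda>q. joint_abs_tailp M Z X Y (c *\<^sub>R q))
    \<in> o[at_top \<times>\<^sub>F at_top \<times>\<^sub>F at_top](\<lambda>q. joint_tailp M X Y (snd q)))"

lemma joint_tailp_nonneg: "0 \<le> joint_tailp M X Y p"
  by (simp add: joint_tailp_def)

lemma exceedance_in_sets [measurable]:
  assumes [measurable]: "X \<in> borel_measurable M" "Y \<in> borel_measurable M"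
  shows "exceedance M X Y p \<in> sets M"
  by (cases p) (simp add: exceedance_def)

context prob_space
begin

lemma antimono_tailp:
  assumes [measurable]: "X \<in> borel_measurable M"
  shows "antimono (tailp M X)"
  unfolding tailp_def by (intro antimonoI finite_measure_mono) auto

lemma antimono_joint_tailp:
  assumes [measurable]: "X \<in> borel_measurable M" "Y \<in> borel_measurable M"
  shows "antimono (joint_tailp M X Y)"
  unfolding joint_tailp_def
  by (intro antimonoI finite_measure_mono) (auto simp: exceedance_def less_eq_prod_def)

lemma indep_var_joint_tailp:
  assumes "indep_var borel X borel Y"
  shows "joint_tailp M X Y p = tailp M X (fst p) * tailp M Y (snd p)"
  using indep_varD[OF assms, of "{fst p<..}" "{snd p<..}"]
  by (simp add: joint_tailp_def exceedance_def split_def tailp_def vimage_def Int_def conj_commute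
      mem_Times_iff)

lemma SAI_imp_joint_tailp_asymp_equiv:
  assumes "SAI M X Y C"
  shows "joint_tailp M X Y \<sim>[at_top \<times>\<^sub>F at_top] (\<lambda>p. C * tailp M X (fst p) * tailp M Y (snd p))"
  using assms by (simp add: SAI_def joint_tailp_def[abs_def] exceedance_def split_def)

lemma joint_class_if_SAI_or_indep_var:
  assumes meas: "X \<in> borel_measurable M" "Y \<in> borel_measurable M"
    and pos: "\<And>x. 0 < tailp M X x" "\<And>y. 0 < tailp M Y y"
    and X: "classD (tailp M X)" "classL (tailp M X)"
    and Y: "classD (tailp M Y)" "classL (tailp M Y)"
    and SAI_or_indep: "SAI M X Y C \<or> indep_var borel X borel Y"
  shows "joint_classD (joint_tailp M X Y)" and "joint_classL (joint_tailp M X Y)"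
proof -
  obtain c where asymp: "joint_tailp M X Y
      \<sim>[at_top \<times>\<^sub>F at_top] (\<lambda>p. c * tailp M X (fst p) * tailp M Y (snd p))"
    using SAI_or_indep
  proof
    assume "indep_var borel X borel Y"
    from indep_var_joint_tailp[OF this] that[of 1] show thesis
      by (simp add: asymp_equiv_refl_ev)
  qed (rule that[OF SAI_imp_joint_tailp_asymp_equiv])
  show "joint_classD (joint_tailp M X Y)"
    by (intro joint_classD_asymp_equiv[OF asymp] joint_classD_times antimono_tailp meas pos X Y)
  show "joint_classL (joint_tailp M X Y)"
    by (intro joint_classL_asymp_equiv[OF asymp] joint_classL_times X Y)
qed

lemma tailp_tendsto_at_right:
  assumes Z[measurable]: "Z \<in> borel_measurable M"
  shows "(tailp M Z \<longlongrightarrow> tailp M Z a) (at_right a)"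
proof -
  interpret Z: real_distribution "distr M borel Z" by simp
  have "tailp M Z x = 1 - cdf (distr M borel Z) x" for x
  proof -
    have "{\<omega>\<in>space M. Z \<omega> > x} = space M - Z -` {..x} \<inter> space M"
      by auto
    then show ?thesis
      by (simp add: tailp_def cdf_def measure_distr prob_compl)
  qed
  then have "tailp M Z = (\<lambda>x. 1 - cdf (distr M borel Z) x)"
    by (rule ext)
  then show ?thesis
    using Z.cdf_is_right_cont[of a] by (auto simp: continuous_within intro!: tendsto_intros)
qed

lemma cprob_tendsto_0_imp_smallo:
  assumes B_events: "\<And>z. {\<omega>\<in>space M. B z \<omega>} \<in> events"
    and lim: "((\<lambda>z. cprob M (A z) (B z)) \<longlongrightarrow> 0) F"
  shows "(\<lambda>z. prob {\<omega>\<in>space M. A z \<omega> \<and> B z \<omega>}) \<in> o[F](\<lambda>z. prob {\<omega>\<in>space M. B z \<omega>})"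
proof (rule landau_o.smallI)
  fix c :: real assume "0 < c"
  with lim have "\<forall>\<^sub>F z in F. cprob M (A z) (B z) < c"
    by (rule order_tendstoD)
  then show "\<forall>\<^sub>F z in F.
      norm (prob {\<omega>\<in>space M. A z \<omega> \<and> B z \<omega>}) \<le> c * norm (prob {\<omega>\<in>space M. B z \<omega>})"
  proof eventually_elim
    case (elim z)
    have "prob {\<omega>\<in>space M. A z \<omega> \<and> B z \<omega>} \<le> prob {\<omega>\<in>space M. B z \<omega>}"
      by (intro finite_measure_mono B_events) auto
    then show ?case
      using elim \<open>0 < c\<close> measure_nonneg[of M "{\<omega>\<in>space M. B z \<omega>}"]
      by (cases "prob {\<omega>\<in>space M. B z \<omega>} = 0") (auto simp: cprob_def divide_less_eq)
  qed
qed

lemma cprob_tendsto_0_imp_tail_negligible: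
  assumes [measurable]: "X \<in> borel_measurable M" "Y \<in> borel_measurable M"
    and joint_D: "joint_classD (joint_tailp M X Y)"
    and lim: "((\<lambda>(z, x, y). cprob M (\<lambda>\<omega>. \<bar>Z \<omega>\<bar> > z) (\<lambda>\<omega>. X \<omega> > x \<and> Y \<omega> > y)) \<longlongrightarrow> 0)
      (at_top \<times>\<^sub>F at_top \<times>\<^sub>F at_top)"
  shows "tail_negligible M Z X Y"
  unfolding tail_negligible_def
proof (intro allI impI)
  fix c :: real assume c_pos: "0 < c"
  have "joint_abs_tailp M Z X Y \<in> o[at_top \<times>\<^sub>F at_top \<times>\<^sub>F at_top](\<lambda>q. joint_tailp M X Y (snd q))"
    using cprob_tendsto_0_imp_smallo[OF _ lim[unfolded split_def]]
    by (simp add: joint_abs_tailp_def[abs_def] joint_tailp_def exceedance_def split_def conj_ac)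
  from landau_o.small.compose[OF this filterlim_scaleR_prod_filter[OF
      filterlim_scaleR_at_top_real[OF c_pos] filterlim_scaleR_prod_at_top[OF c_pos]]]
  have "(\<lambda>q. joint_abs_tailp M Z X Y (c *\<^sub>R q))
      \<in> o[at_top \<times>\<^sub>F at_top \<times>\<^sub>F at_top](\<lambda>q. joint_tailp M X Y (c *\<^sub>R snd q))"
    by simp
  also have "(\<lambda>q. joint_tailp M X Y (c *\<^sub>R snd q))
      \<in> O[at_top \<times>\<^sub>F at_top \<times>\<^sub>F at_top](\<lambda>q. joint_tailp M X Y (snd q))"
    using joint_D c_pos
    by (intro landau_o.big.compose[OF _ filterlim_snd]) (simp add: joint_classD_def)
  finally show "(\<lambda>q. joint_abs_tailp M Z X Y (c *\<^sub>R q))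
      \<in> o[at_top \<times>\<^sub>F at_top \<times>\<^sub>F at_top](\<lambda>q. joint_tailp M X Y (snd q))" .
qed

end

subsection \<open>Conditioning on an independent variable\<close>

context prob_space
begin

lemma indep_var_emeasure_eq_nn_integral:
  assumes indep: "indep_var S W T Z" and A[measurable]: "Measurable.pred (S \<Otimes>\<^sub>M T) A"
  shows "emeasure M {\<omega>\<in>space M. A (W \<omega>, Z \<omega>)} =
    (\<integral>\<^sup>+w. emeasure M {\<omega>\<in>space M. A (w, Z \<omega>)} \<partial>distr M S W)"
proof -
  have W[measurable]: "W \<in> measurable M S" and Z[measurable]: "Z \<in> measurable M T"
    and joint: "distr M S W \<Otimes>\<^sub>M distr M T Z = distr M (S \<Otimes>\<^sub>M T) (\<lambda>\<omega>. (W \<omega>, Z \<omega>))"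
    using indep by (auto simp: indep_var_distribution_eq)
  interpret Z: prob_space "distr M T Z" by (rule prob_space_distr) simp
  let ?A = "{p\<in>space (S \<Otimes>\<^sub>M T). A p}"
  have "emeasure M {\<omega>\<in>space M. A (W \<omega>, Z \<omega>)} = emeasure (distr M S W \<Otimes>\<^sub>M distr M T Z) ?A"
    unfolding joint using measurable_space[OF W] measurable_space[OF Z]
    by (auto simp: emeasure_distr space_pair_measure intro!: arg_cong[where f = "emeasure M"])
  also have "\<dots> = (\<integral>\<^sup>+w. emeasure (distr M T Z) (Pair w -` ?A) \<partial>distr M S W)"
    by (rule Z.emeasure_pair_measure_alt) simp
  also have "\<dots> = (\<integral>\<^sup>+w. emeasure M {\<omega>\<in>space M. A (w, Z \<omega>)} \<partial>distr M S W)"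
  proof (intro nn_integral_cong)
    fix w assume "w \<in> space (distr M S W)"
    then show "emeasure (distr M T Z) (Pair w -` ?A) = emeasure M {\<omega>\<in>space M. A (w, Z \<omega>)}"
      using measurable_space[OF Z]
      by (auto simp: emeasure_distr sets_Pair1 space_pair_measure
          intro!: arg_cong[where f = "emeasure M"])
  qed
  finally show ?thesis .
qed

lemma indep_var_prob_le_if_conditional_le:
  assumes indep: "indep_var S W T Z"
    and Q[measurable]: "Measurable.pred (S \<Otimes>\<^sub>M T) Q"
    and R[measurable]: "Measurable.pred (S \<Otimes>\<^sub>M T) R"
    and K_nonneg: "0 \<le> K"
    and conditional_le: "\<And>w. w \<in> space S \<Longrightarrow>
      prob {\<omega>\<in>space M. Q (w, Z \<omega>)} \<le> K * prob {\<omega>\<in>space M. R (w, Z \<omega>)}"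
  shows "prob {\<omega>\<in>space M. Q (W \<omega>, Z \<omega>)} \<le> K * prob {\<omega>\<in>space M. R (W \<omega>, Z \<omega>)}"
proof -
  have [measurable]: "W \<in> measurable M S" "Z \<in> measurable M T"
    using indep by (auto simp: indep_var_distribution_eq)
  have "emeasure M {\<omega>\<in>space M. Q (W \<omega>, Z \<omega>)} =
      (\<integral>\<^sup>+w. emeasure M {\<omega>\<in>space M. Q (w, Z \<omega>)} \<partial>distr M S W)"
    by (rule indep_var_emeasure_eq_nn_integral[OF indep Q])
  also have "\<dots> \<le> (\<integral>\<^sup>+w. K * emeasure M {\<omega>\<in>space M. R (w, Z \<omega>)} \<partial>distr M S W)"
    by (intro nn_integral_mono)
      (use K_nonneg conditional_le in
        \<open>simp add: emeasure_eq_measure ennreal_mult[symmetric] ennreal_leI\<close>)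
  also have "\<dots> = K * (\<integral>\<^sup>+w. emeasure M {\<omega>\<in>space M. R (w, Z \<omega>)} \<partial>distr M S W)"
    by (rule nn_integral_cmult) measurable
  also have "\<dots> = K * emeasure M {\<omega>\<in>space M. R (W \<omega>, Z \<omega>)}"
    by (simp only: indep_var_emeasure_eq_nn_integral[OF indep R])
  finally show ?thesis
    using K_nonneg by (simp add: emeasure_eq_measure ennreal_mult[symmetric])
qed

end

subsection \<open>Bounded independent weights\<close>

lemma less_mult_imp_divide_less:
  fixes t u z b :: real
  assumes "z < t * u" "0 \<le> z" "0 \<le> t" "t \<le> b"
  shows "0 < t" and "z / b < u"
proof -
  have "0 < t * u" using assms(1,2) by linarith
  then have factors_pos: "0 < t" "0 < u"
    using assms(3) by (auto simp: zero_less_mult_iff)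
  then show "0 < t" by simp
  have "z < b * u"
    using assms(1) mult_right_mono[OF assms(4), of u] factors_pos(2) by linarith
  then show "z / b < u"
    using factors_pos(1) assms(4) by (simp add: pos_divide_less_eq mult.commute)
qed

locale weighted_pair = prob_space M for M :: "'a measure" +
  fixes X Y Th De :: "'a \<Rightarrow> real" and b :: real
  assumes X[measurable]: "X \<in> borel_measurable M" and Y[measurable]: "Y \<in> borel_measurable M"
    and Th[measurable]: "Th \<in> borel_measurable M" and De[measurable]: "De \<in> borel_measurable M"
    and Th_nonneg: "\<And>\<omega>. \<omega> \<in> space M \<Longrightarrow> 0 \<le> Th \<omega>"
    and De_nonneg: "\<And>\<omega>. \<omega> \<in> space M \<Longrightarrow> 0 \<le> De \<omega>"
    and b_pos: "0 < b"
    and Th_le: "AE \<omega> in M. Th \<omega> \<le> b" and De_le: "AE \<omega> in M. De \<omega> \<le> b"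
    and indep: "indep_var (borel \<Otimes>\<^sub>M borel) (\<lambda>\<omega>. (Th \<omega>, De \<omega>)) (borel \<Otimes>\<^sub>M borel) (\<lambda>\<omega>. (X \<omega>, Y \<omega>))"
    and tail_D: "joint_classD (joint_tailp M X Y)" and tail_L: "joint_classL (joint_tailp M X Y)"
begin

lemma AE_abs_weights_le: "AE \<omega> in M. \<bar>Th \<omega>\<bar> \<le> b" "AE \<omega> in M. \<bar>De \<omega>\<bar> \<le> b"
  using Th_le De_le AE_space Th_nonneg De_nonneg by (auto elim!: eventually_elim2)

abbreviation weighted_exceedance :: "real \<times> real \<Rightarrow> 'a set" where
  "weighted_exceedance \<equiv> exceedance M (\<lambda>\<omega>. Th \<omega> * X \<omega>) (\<lambda>\<omega>. De \<omega> * Y \<omega>)"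

abbreviation weighted_tailp :: "real \<times> real \<Rightarrow> real" where
  "weighted_tailp \<equiv> joint_tailp M (\<lambda>\<omega>. Th \<omega> * X \<omega>) (\<lambda>\<omega>. De \<omega> * Y \<omega>)"

abbreviation least_weight :: "'a \<Rightarrow> real" where
  "least_weight \<equiv> \<lambda>\<omega>. min (Th \<omega>) (De \<omega>)"

lemma weighted_exceedance_imp:
  assumes "\<omega> \<in> weighted_exceedance p" "0 \<le> p" "Th \<omega> \<le> b" "De \<omega> \<le> b"
  shows "0 < least_weight \<omega>" and "\<omega> \<in> exceedance M X Y (inverse b *\<^sub>R p)"
proof -
  have \<omega>: "\<omega> \<in> space M" and exceeds: "fst p < Th \<omega> * X \<omega>" "snd p < De \<omega> * Y \<omega>"
    and p_nonneg: "0 \<le> fst p" "0 \<le> snd p"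
    using assms(1,2) by (auto simp: exceedance_def less_eq_prod_def split_def)
  note Th = less_mult_imp_divide_less[OF exceeds(1) p_nonneg(1) Th_nonneg[OF \<omega>] assms(3)]
  note De = less_mult_imp_divide_less[OF exceeds(2) p_nonneg(2) De_nonneg[OF \<omega>] assms(4)]
  show "0 < least_weight \<omega>"
    using Th(1) De(1) by simp
  show "\<omega> \<in> exceedance M X Y (inverse b *\<^sub>R p)"
    using \<omega> Th(2) De(2) by (simp add: exceedance_def split_def divide_inverse_commute)
qed

lemma weighted_tailp_eq_0:
  assumes "tailp M least_weight 0 = 0" "0 \<le> p"
  shows "weighted_tailp p = 0"
proof -
  have "weighted_tailp p \<le> tailp M least_weight 0"
    unfolding joint_tailp_def tailp_def
  proof (rule finite_measure_mono_AE)
    show "AE \<omega> in M. \<omega> \<in> weighted_exceedance p \<longrightarrow> \<omega> \<in> {\<omega>\<in>space M. least_weight \<omega> > 0}"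
      using Th_le De_le AE_space
    proof eventually_elim
      case (elim \<omega>)
      with weighted_exceedance_imp(1)[OF _ assms(2), of \<omega>] show ?case by simp
    qed
  qed measurable
  with assms(1) joint_tailp_nonneg show ?thesis by (metis antisym)
qed

lemma prob_exceedance_weights:
  assumes [measurable]: "Measurable.pred (borel \<Otimes>\<^sub>M borel) U"
  shows "prob {\<omega>\<in>exceedance M X Y p. U (Th \<omega>, De \<omega>)} =
    prob {\<omega>\<in>space M. U (Th \<omega>, De \<omega>)} * joint_tailp M X Y p"
proof -
  have U_sets: "Collect U \<in> sets (borel \<Otimes>\<^sub>M borel)"
    using assms by (simp add: pred_def space_pair_measure)
  have V_sets: "{fst p<..} \<times> {snd p<..} \<in> sets (borel \<Otimes>\<^sub>M borel)" by simp
  show ?thesis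
    using indep_varD[OF indep U_sets V_sets]
    by (simp add: joint_tailp_def exceedance_def split_def vimage_def Int_def conj_ac mem_Times_iff)
qed

lemma tailp_least_weight_mult_joint_tailp_le:
  assumes s_pos: "0 < s" and p_nonneg: "0 \<le> p"
  shows "tailp M least_weight s * joint_tailp M X Y (inverse s *\<^sub>R p) \<le> weighted_tailp p"
proof -
  have "tailp M least_weight s * joint_tailp M X Y (inverse s *\<^sub>R p) =
      prob {\<omega>\<in>exceedance M X Y (inverse s *\<^sub>R p). s < Th \<omega> \<and> s < De \<omega>}"
    using prob_exceedance_weights[of "\<lambda>(t, d). s < t \<and> s < d"] by (simp add: tailp_def)
  also have "\<dots> \<le> weighted_tailp p"
    unfolding joint_tailp_def
  proof (intro finite_measure_mono subsetI)
    fix \<omega> assume "\<omega> \<in> {\<omega>\<in>exceedance M X Y (inverse s *\<^sub>R p). s < Th \<omega> \<and> s < De \<omega>}"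
    with p_nonneg s_pos mult_strict_mono[of s "Th \<omega>" "inverse s * fst p" "X \<omega>"]
      mult_strict_mono[of s "De \<omega>" "inverse s * snd p" "Y \<omega>"]
    show "\<omega> \<in> weighted_exceedance p"
      by (auto simp: exceedance_def less_eq_prod_def split_def mult.assoc[symmetric])
  qed measurable
  finally show ?thesis .
qed

lemma joint_tailp_bigo_weighted_tailp:
  assumes pos: "0 < tailp M least_weight 0" and c_pos: "0 < c"
  shows "(\<lambda>p. joint_tailp M X Y (c *\<^sub>R p)) \<in> O[at_top \<times>\<^sub>F at_top](weighted_tailp)"
proof -
  have "\<forall>\<^sub>F s in at_right 0. 0 < tailp M least_weight s \<and> 0 < s"
    using order_tendstoD(1)[OF tailp_tendsto_at_right pos]
    by (intro eventually_conj eventually_at_right_less) simp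
  then obtain s where tailp_s_pos: "0 < tailp M least_weight s" (is "0 < ?q") and s_pos: "0 < s"
    using eventually_happens'[OF trivial_limit_at_right_real] by blast
  let ?unscaled = "\<lambda>p. joint_tailp M X Y (inverse s *\<^sub>R p)"
  have "(\<lambda>p. joint_tailp M X Y (c *\<^sub>R p)) \<in> O[at_top \<times>\<^sub>F at_top](?unscaled)"
    using joint_classD_scaleR_bigo[OF tail_D c_pos] s_pos by simp
  also have "\<forall>\<^sub>F p in at_top \<times>\<^sub>F at_top. norm (?unscaled p) \<le> inverse ?q * norm (weighted_tailp p)"
    using eventually_ge_prod_at_top[of 0]
  proof eventually_elim
    case (elim p)
    with tailp_least_weight_mult_joint_tailp_le[OF s_pos, of p] tailp_s_pos show ?case
      by (simp add: joint_tailp_nonneg field_simps)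
  qed
  then have "?unscaled \<in> O[at_top \<times>\<^sub>F at_top](weighted_tailp)"
    by (rule bigoI)
  finally show ?thesis .
qed

lemma prob_weighted_exceedance_small_weights_le:
  assumes p_nonneg: "0 \<le> p" and s_pos: "0 < s"
  shows "prob {\<omega>\<in>weighted_exceedance p. least_weight \<omega> \<le> s}
    \<le> (tailp M least_weight 0 - tailp M least_weight s) * joint_tailp M X Y (inverse b *\<^sub>R p)"
proof -
  have "prob {\<omega>\<in>weighted_exceedance p. least_weight \<omega> \<le> s}
      \<le> prob {\<omega>\<in>exceedance M X Y (inverse b *\<^sub>R p). 0 < least_weight \<omega> \<and> least_weight \<omega> \<le> s}"
  proof (rule finite_measure_mono_AE)
    show "AE \<omega> in M. \<omega> \<in> {\<omega>\<in>weighted_exceedance p. least_weight \<omega> \<le> s} \<longrightarrow>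
        \<omega> \<in> {\<omega>\<in>exceedance M X Y (inverse b *\<^sub>R p). 0 < least_weight \<omega> \<and> least_weight \<omega> \<le> s}"
      using Th_le De_le
    proof eventually_elim
      case (elim \<omega>)
      with weighted_exceedance_imp[OF _ p_nonneg, of \<omega>] show ?case by simp
    qed
  qed measurable
  also have "\<dots> = prob {\<omega>\<in>space M. 0 < least_weight \<omega> \<and> least_weight \<omega> \<le> s} *
      joint_tailp M X Y (inverse b *\<^sub>R p)"
    using prob_exceedance_weights[of "\<lambda>(t, d). 0 < min t d \<and> min t d \<le> s"] by simp
  also have "{\<omega>\<in>space M. 0 < least_weight \<omega> \<and> least_weight \<omega> \<le> s} =
      {\<omega>\<in>space M. 0 < least_weight \<omega>} - {\<omega>\<in>space M. s < least_weight \<omega>}"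
    by auto
  also have "prob \<dots> = tailp M least_weight 0 - tailp M least_weight s"
    unfolding tailp_def using s_pos by (intro finite_measure_Diff) auto
  finally show ?thesis .
qed

lemma small_weights_negligible:
  assumes pos: "0 < tailp M least_weight 0" and a_pos: "0 < a" and e_pos: "0 < e"
  shows "\<exists>s>0. \<forall>\<^sub>F p in at_top \<times>\<^sub>F at_top.
    prob {\<omega>\<in>weighted_exceedance (p - (a, a)). least_weight \<omega> \<le> s} \<le> e * weighted_tailp p"
proof -
  let ?shifted = "\<lambda>p. joint_tailp M X Y (inverse b *\<^sub>R (p - (a, a)))"
  have "(\<lambda>p. joint_tailp M X Y (p - (a / b, a / b))) \<sim>[at_top \<times>\<^sub>F at_top] joint_tailp M X Y"
    using tail_L a_pos b_pos by (simp add: joint_classL_def)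
  from asymp_equiv_compose'[OF this filterlim_scaleR_prod_at_top, of "inverse b"]
  have "?shifted \<in> O[at_top \<times>\<^sub>F at_top](\<lambda>p. joint_tailp M X Y (inverse b *\<^sub>R p))"
    using b_pos by (intro asymp_equiv_imp_bigo) (simp add: scaleR_diff_right divide_inverse_commute)
  also have "(\<lambda>p. joint_tailp M X Y (inverse b *\<^sub>R p)) \<in> O[at_top \<times>\<^sub>F at_top](weighted_tailp)"
    using b_pos by (intro joint_tailp_bigo_weighted_tailp pos) simp
  finally obtain K where K_pos: "0 < K"
    and shifted_le: "\<forall>\<^sub>F p in at_top \<times>\<^sub>F at_top. norm (?shifted p) \<le> K * norm (weighted_tailp p)"
    by (rule landau_o.bigE)
  have "\<forall>\<^sub>F s in at_right 0. tailp M least_weight 0 - e / K < tailp M least_weight s \<and> 0 < s"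
    using e_pos K_pos by (intro eventually_conj eventually_at_right_less
        order_tendstoD(1)[OF tailp_tendsto_at_right]) auto
  then obtain s where s_pos: "0 < s"
    and tailp_close: "tailp M least_weight 0 - e / K < tailp M least_weight s"
    using eventually_happens'[OF trivial_limit_at_right_real] by blast
  have "\<forall>\<^sub>F p in at_top \<times>\<^sub>F at_top.
      prob {\<omega>\<in>weighted_exceedance (p - (a, a)). least_weight \<omega> \<le> s} \<le> e * weighted_tailp p"
    using shifted_le eventually_ge_prod_at_top[of "(a, a)"]
  proof eventually_elim
    case (elim p)
    have "prob {\<omega>\<in>weighted_exceedance (p - (a, a)). least_weight \<omega> \<le> s}
        \<le> (tailp M least_weight 0 - tailp M least_weight s) * ?shifted p"
      using elim s_pos
      by (intro prob_weighted_exceedance_small_weights_le) (auto simp: less_eq_prod_def)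
    also have "\<dots> \<le> e / K * (K * weighted_tailp p)"
      using elim tailp_close e_pos K_pos by (intro mult_mono) (auto simp: joint_tailp_nonneg)
    finally show ?case
      using K_pos by simp
  qed
  with s_pos show ?thesis by blast
qed

lemma joint_tailp_shift_divide_le:
  assumes s_pos: "0 < s" and a_pos: "0 < a" and e_pos: "0 < e"
  shows "\<forall>\<^sub>F p in at_top \<times>\<^sub>F at_top. \<forall>t\<in>{s<..b}. \<forall>d\<in>{s<..b}.
    joint_tailp M X Y ((fst p - a) / t, (snd p - a) / d)
      \<le> (1 + e) * joint_tailp M X Y (fst p / t, snd p / d)"
proof -
  have "\<forall>\<^sub>F p in at_top \<times>\<^sub>F at_top.
      joint_tailp M X Y (p - (a / s, a / s)) \<le> (1 + e) * joint_tailp M X Y p"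
    using a_pos s_pos e_pos
    by (intro joint_classL_imp_eventually_bounds[OF tail_L joint_tailp_nonneg]) auto
  from eventually_prod_at_top_divide[OF this b_pos] show ?thesis
  proof eventually_elim
    case (elim p)
    show ?case
    proof (intro ballI)
      fix t d assume weights_in_range: "t \<in> {s<..b}" "d \<in> {s<..b}"
      have "joint_tailp M X Y ((fst p - a) / t, (snd p - a) / d)
          \<le> joint_tailp M X Y ((fst p / t, snd p / d) - (a / s, a / s))"
        using weights_in_range s_pos a_pos by (intro antimonoD[OF antimono_joint_tailp[OF X Y]])
          (auto simp: less_eq_prod_def diff_divide_distrib intro!: divide_left_mono)
      also have "\<dots> \<le> (1 + e) * joint_tailp M X Y (fst p / t, snd p / d)"
        using elim weights_in_range s_pos by auto
      finally show "joint_tailp M X Y ((fst p - a) / t, (snd p - a) / d)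
          \<le> (1 + e) * joint_tailp M X Y (fst p / t, snd p / d)" .
    qed
  qed
qed

lemma prob_weighted_exceedance_large_weights_le:
  assumes s_pos: "0 < s" and K_nonneg: "0 \<le> K"
    and conditional_le: "\<And>t d. t \<in> {s<..b} \<Longrightarrow> d \<in> {s<..b} \<Longrightarrow>
      joint_tailp M X Y (fst q / t, snd q / d) \<le> K * joint_tailp M X Y (fst p / t, snd p / d)"
  shows "prob {\<omega>\<in>weighted_exceedance q. Th \<omega> \<in> {s<..b} \<and> De \<omega> \<in> {s<..b}} \<le> K * weighted_tailp p"
proof -
  define large :: "real \<times> real \<Rightarrow> (real \<times> real) \<times> real \<times> real \<Rightarrow> bool" where
    "large r = (\<lambda>((t, d), x, y). t \<in> {s<..b} \<and> d \<in> {s<..b} \<and> fst r < t * x \<and> snd r < d * y)" for r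
  have large_measurable: "Measurable.pred ((borel \<Otimes>\<^sub>M borel) \<Otimes>\<^sub>M (borel \<Otimes>\<^sub>M borel)) (large r)" for r
    unfolding large_def split_def greaterThanAtMost_iff by measurable
  have large_event: "{\<omega>\<in>weighted_exceedance r. Th \<omega> \<in> {s<..b} \<and> De \<omega> \<in> {s<..b}} =
      {\<omega>\<in>space M. large r ((Th \<omega>, De \<omega>), X \<omega>, Y \<omega>)}" for r
    by (auto simp: large_def exceedance_def)
  have "prob {\<omega>\<in>space M. large q ((Th \<omega>, De \<omega>), X \<omega>, Y \<omega>)}
      \<le> K * prob {\<omega>\<in>space M. large p ((Th \<omega>, De \<omega>), X \<omega>, Y \<omega>)}"
  proof (rule indep_var_prob_le_if_conditional_le[OF indep large_measurable large_measurable
        K_nonneg])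
    fix w :: "real \<times> real"
    obtain t d where w_eq: "w = (t, d)" by (cases w)
    have "prob {\<omega>\<in>space M. large r (w, X \<omega>, Y \<omega>)} =
        (if t \<in> {s<..b} \<and> d \<in> {s<..b} then joint_tailp M X Y (fst r / t, snd r / d) else 0)" for r
    proof (cases "t \<in> {s<..b} \<and> d \<in> {s<..b}")
      case True
      with s_pos show ?thesis
        by (simp add: w_eq large_def joint_tailp_def exceedance_def divide_less_eq mult.commute)
    next
      case False
      then have "{\<omega>\<in>space M. large r (w, X \<omega>, Y \<omega>)} = {}"
        by (auto simp: w_eq large_def)
      with False show ?thesis by (simp only: measure_empty if_False)
    qed
    with conditional_le show "prob {\<omega>\<in>space M. large q (w, X \<omega>, Y \<omega>)}
        \<le> K * prob {\<omega>\<in>space M. large p (w, X \<omega>, Y \<omega>)}"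
      by simp
  qed
  also have "\<dots> \<le> K * weighted_tailp p"
    unfolding large_event[symmetric] joint_tailp_def
    using K_nonneg by (intro mult_left_mono finite_measure_mono) auto
  finally show ?thesis unfolding large_event .
qed

lemma weighted_tailp_shift_le:
  assumes pos: "0 < tailp M least_weight 0" and a_pos: "0 < a" and e_pos: "0 < e"
  shows "\<forall>\<^sub>F p in at_top \<times>\<^sub>F at_top. weighted_tailp (p - (a, a)) \<le> (1 + e) * weighted_tailp p"
proof -
  have half_pos: "0 < e / 2" using e_pos by simp
  obtain s where s_pos: "0 < s" and small: "\<forall>\<^sub>F p in at_top \<times>\<^sub>F at_top.
      prob {\<omega>\<in>weighted_exceedance (p - (a, a)). least_weight \<omega> \<le> s} \<le> e / 2 * weighted_tailp p"
    using small_weights_negligible[OF pos a_pos half_pos] by blast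
  show ?thesis
    using small joint_tailp_shift_divide_le[OF s_pos a_pos half_pos]
  proof eventually_elim
    case (elim p)
    let ?large = "{\<omega>\<in>weighted_exceedance (p - (a, a)). Th \<omega> \<in> {s<..b} \<and> De \<omega> \<in> {s<..b}}"
    let ?small = "{\<omega>\<in>weighted_exceedance (p - (a, a)). least_weight \<omega> \<le> s}"
    have "weighted_tailp (p - (a, a)) \<le> prob (?large \<union> ?small)"
      unfolding joint_tailp_def
    proof (rule finite_measure_mono_AE)
      show "AE \<omega> in M. \<omega> \<in> weighted_exceedance (p - (a, a)) \<longrightarrow> \<omega> \<in> ?large \<union> ?small"
        using Th_le De_le by eventually_elim auto
    qed measurable
    also have "\<dots> \<le> prob ?large + prob ?small"
      by (intro measure_Un_le) measurable
    also have "\<dots> \<le> (1 + e / 2) * weighted_tailp p + e / 2 * weighted_tailp p"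
      using elim e_pos by (intro add_mono prob_weighted_exceedance_large_weights_le[OF s_pos]) auto
    also have "\<dots> = (1 + e) * weighted_tailp p"
      by (simp add: ring_distribs)
    finally show ?case .
  qed
qed

theorem joint_classL_weighted_tailp: "joint_classL weighted_tailp"
  unfolding joint_classL_def
proof (intro allI impI)
  fix a :: real assume a_pos: "0 < a"
  show "(\<lambda>p. weighted_tailp (p - (a, a))) \<sim>[at_top \<times>\<^sub>F at_top] weighted_tailp"
  proof (cases "tailp M least_weight 0 = 0")
    case True
    have "\<forall>\<^sub>F p in at_top \<times>\<^sub>F at_top. weighted_tailp (p - (a, a)) = weighted_tailp p"
      using eventually_ge_prod_at_top[of 0] eventually_ge_prod_at_top[of "(a, a)"]
      by eventually_elim (use weighted_tailp_eq_0[OF True] in \<open>simp add: less_eq_prod_def\<close>)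
    then show ?thesis by (rule asymp_equiv_refl_ev)
  next
    case False
    then have pos: "0 < tailp M least_weight 0"
      by (simp add: tailp_def less_le)
    have "(1 - e) * weighted_tailp p \<le> weighted_tailp (p - (a, a))" if "0 < e" for e p
    proof -
      have "(1 - e) * weighted_tailp p \<le> weighted_tailp p"
        using that by (simp add: joint_tailp_nonneg algebra_simps)
      also have "\<dots> \<le> weighted_tailp (p - (a, a))"
        using a_pos by (intro antimonoD[OF antimono_joint_tailp]) (simp_all add: less_eq_prod_def)
      finally show ?thesis .
    qed
    with weighted_tailp_shift_le[OF pos a_pos] show ?thesis
      by (simp add: asymp_equiv_iff_eventually_bounds joint_tailp_nonneg)
  qed
qed

lemma joint_abs_tailp_weighted_le:
  assumes [measurable]: "Z \<in> borel_measurable M" "W \<in> borel_measurable M"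
    and W_le: "AE \<omega> in M. \<bar>W \<omega>\<bar> \<le> b" and q_nonneg: "0 \<le> q"
  shows "joint_abs_tailp M (\<lambda>\<omega>. W \<omega> * Z \<omega>) (\<lambda>\<omega>. Th \<omega> * X \<omega>) (\<lambda>\<omega>. De \<omega> * Y \<omega>) q
    \<le> joint_abs_tailp M Z X Y (inverse b *\<^sub>R q)"
  unfolding joint_abs_tailp_def
proof (rule finite_measure_mono_AE)
  have components_nonneg: "0 \<le> fst q" "0 \<le> snd q" using q_nonneg by (simp_all add: less_eq_prod_def)
  show "AE \<omega> in M. \<omega> \<in> {\<omega>\<in>weighted_exceedance (snd q). \<bar>W \<omega> * Z \<omega>\<bar> > fst q} \<longrightarrow>
      \<omega> \<in> {\<omega>\<in>exceedance M X Y (snd (inverse b *\<^sub>R q)). \<bar>Z \<omega>\<bar> > fst (inverse b *\<^sub>R q)}"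
    using Th_le De_le W_le
  proof eventually_elim
    case (elim \<omega>)
    with weighted_exceedance_imp(2)[OF _ components_nonneg(2), of \<omega>]
      less_mult_imp_divide_less(2)[OF _ components_nonneg(1), of "\<bar>W \<omega>\<bar>" "\<bar>Z \<omega>\<bar>" b]
    show ?case by (simp add: abs_mult divide_inverse_commute)
  qed
qed measurable

lemma joint_abs_tailp_weighted_eq_0:
  assumes "tailp M least_weight 0 = 0" "0 \<le> q"
  shows "joint_abs_tailp M Z (\<lambda>\<omega>. Th \<omega> * X \<omega>) (\<lambda>\<omega>. De \<omega> * Y \<omega>) q = 0"
proof -
  have "joint_abs_tailp M Z (\<lambda>\<omega>. Th \<omega> * X \<omega>) (\<lambda>\<omega>. De \<omega> * Y \<omega>) q \<le> weighted_tailp (snd q)"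
    unfolding joint_abs_tailp_def joint_tailp_def by (intro finite_measure_mono) auto
  also have "\<dots> = 0"
    using assms by (intro weighted_tailp_eq_0) (auto simp: less_eq_prod_def)
  finally show ?thesis
    by (simp add: joint_abs_tailp_def measure_le_0_iff)
qed

theorem tail_negligible_weighted:
  assumes Z: "Z \<in> borel_measurable M" and W: "W \<in> borel_measurable M"
    and W_le: "AE \<omega> in M. \<bar>W \<omega>\<bar> \<le> b" and negl: "tail_negligible M Z X Y"
  shows "tail_negligible M (\<lambda>\<omega>. W \<omega> * Z \<omega>) (\<lambda>\<omega>. Th \<omega> * X \<omega>) (\<lambda>\<omega>. De \<omega> * Y \<omega>)"
  unfolding tail_negligible_def
proof (intro allI impI)
  fix c :: real assume c_pos: "0 < c"
  let ?F = "at_top \<times>\<^sub>F at_top \<times>\<^sub>F at_top :: (real \<times> real \<times> real) filter"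
  let ?weighted = "joint_abs_tailp M (\<lambda>\<omega>. W \<omega> * Z \<omega>) (\<lambda>\<omega>. Th \<omega> * X \<omega>) (\<lambda>\<omega>. De \<omega> * Y \<omega>)"
  let ?unweighted = "\<lambda>q. joint_abs_tailp M Z X Y ((c / b) *\<^sub>R q)"
  have "\<forall>\<^sub>F q in ?F. 0 \<le> fst q \<and> 0 \<le> snd q"
    by (intro eventually_conj eventually_compose_filterlim[OF eventually_ge_at_top filterlim_fst]
        eventually_compose_filterlim[OF eventually_ge_prod_at_top filterlim_snd])
  then have nonneg: "\<forall>\<^sub>F q in ?F. 0 \<le> c *\<^sub>R q"
    by eventually_elim (use c_pos in \<open>simp add: less_eq_prod_def\<close>)
  show "(\<lambda>q. ?weighted (c *\<^sub>R q)) \<in> o[?F](\<lambda>q. weighted_tailp (snd q))"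
  proof (cases "tailp M least_weight 0 = 0")
    case True
    have "\<forall>\<^sub>F q in ?F. ?weighted (c *\<^sub>R q) = 0"
      using nonneg by eventually_elim (rule joint_abs_tailp_weighted_eq_0[OF True])
    then show ?thesis by (simp add: landau_o.small.in_cong)
  next
    case False
    then have pos: "0 < tailp M least_weight 0"
      by (simp add: tailp_def less_le)
    have "\<forall>\<^sub>F q in ?F. norm (?weighted (c *\<^sub>R q)) \<le> 1 * norm (?unweighted q)"
      using nonneg
    proof eventually_elim
      case (elim q)
      from joint_abs_tailp_weighted_le[OF Z W W_le elim] show ?case
        by (simp add: joint_abs_tailp_def divide_inverse_commute)
    qed
    then have "(\<lambda>q. ?weighted (c *\<^sub>R q)) \<in> O[?F](?unweighted)"
      by (rule bigoI)
    also have "?unweighted \<in> o[?F](\<lambda>q. joint_tailp M X Y (snd q))"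
      using negl c_pos b_pos by (simp add: tail_negligible_def)
    also have "(\<lambda>q. joint_tailp M X Y (snd q)) \<in> O[?F](\<lambda>q. weighted_tailp (snd q))"
      using joint_tailp_bigo_weighted_tailp[OF pos, of 1]
      by (intro landau_o.big.compose[OF _ filterlim_snd]) simp
    finally show ?thesis .
  qed
qed

end

subsection \<open>Joint tails of sums\<close>

lemma sum_gt_imp_ex_gt:
  fixes u :: "'i \<Rightarrow> real"
  assumes "real (card I) * c \<le> 1" "0 \<le> z" "z < (\<Sum>i\<in>I. u i)"
  shows "\<exists>i\<in>I. c * z < u i"
proof (rule ccontr)
  assume "\<not> ?thesis"
  then have "(\<Sum>i\<in>I. u i) \<le> real (card I) * (c * z)"
    by (intro sum_bounded_above) (auto simp: not_less)
  also have "\<dots> \<le> z"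
    using mult_right_mono[OF assms(1,2)] by (simp add: mult.assoc)
  finally show False
    using assms(3) by simp
qed

lemma sum_gt_imp_large_term:
  fixes u :: "'i \<Rightarrow> real"
  assumes finite_I: "finite I" and c_bounds: "0 \<le> c" "real (card I) * c \<le> 1"
    and x_nonneg: "0 \<le> x" and a_nonneg: "0 \<le> a"
    and sum_gt: "x < (\<Sum>i\<in>I. u i)"
  shows "\<exists>k\<in>I. c * x < u k \<and> (x - a < u k \<or> (\<exists>i\<in>I - {k}. c * a < \<bar>u i\<bar>))"
proof -
  obtain k where large_k: "k \<in> I" "c * x < u k"
    using sum_gt_imp_ex_gt[OF c_bounds(2) x_nonneg sum_gt] by blast
  have "\<exists>i\<in>I - {k}. c * a < \<bar>u i\<bar>" if "u k \<le> x - a"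
  proof -
    have "a < (\<Sum>i\<in>I - {k}. u i)"
      using that sum_gt sum.remove[OF finite_I large_k(1), of u] by simp
    moreover have "real (card (I - {k})) * c \<le> 1"
      using c_bounds mult_right_mono[of "real (card (I - {k}))" "real (card I)" c]
        card_mono[OF finite_I, of "I - {k}"] by simp
    ultimately obtain i where "i \<in> I - {k}" "c * a < u i"
      using sum_gt_imp_ex_gt a_nonneg by blast
    then show ?thesis by force
  qed
  with large_k show ?thesis by force
qed

lemma large_term_imp_sum_gt:
  fixes u :: "'i \<Rightarrow> real"
  assumes finite_I: "finite I" and c_bounds: "0 \<le> c" "real (card I) * c \<le> 1"
    and a_nonneg: "0 \<le> a"
    and large_k: "k \<in> I" "x + a < u k" and small: "\<And>i. i \<in> I - {k} \<Longrightarrow> \<bar>u i\<bar> \<le> c * a"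
  shows "x < (\<Sum>i\<in>I. u i)"
proof -
  have "(\<Sum>i\<in>I - {k}. - u i) \<le> real (card (I - {k})) * (c * a)"
    using small by (intro sum_bounded_above) (auto simp: abs_le_iff)
  also have "\<dots> \<le> real (card I) * (c * a)"
    using card_mono[OF finite_I, of "I - {k}"] c_bounds a_nonneg by (intro mult_right_mono) auto
  also have "\<dots> \<le> a"
    using mult_right_mono[OF c_bounds(2) a_nonneg] by (simp add: mult.assoc)
  finally show ?thesis
    using large_k(2) sum.remove[OF finite_I large_k(1), of u] by (simp add: sum_negf)
qed

locale two_random_sums = prob_space M for M :: "'a measure" +
  fixes I :: "'i set" and J :: "'j set" and U :: "'i \<Rightarrow> 'a \<Rightarrow> real" and V :: "'j \<Rightarrow> 'a \<Rightarrow> real"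
  assumes finite_I: "finite I" and finite_J: "finite J"
    and U[measurable]: "\<And>k. k \<in> I \<Longrightarrow> U k \<in> borel_measurable M"
    and V[measurable]: "\<And>l. l \<in> J \<Longrightarrow> V l \<in> borel_measurable M"
begin

definition share :: real where
  "share = 1 / real (1 + card I + card J)"

definition disturbed :: "'i \<Rightarrow> 'j \<Rightarrow> real \<times> real \<times> real \<Rightarrow> 'a set" where
  "disturbed k l q = {\<omega>\<in>exceedance M (U k) (V l) (share *\<^sub>R snd q).
    (\<exists>i\<in>I - {k}. \<bar>U i \<omega>\<bar> > share * fst q) \<or> (\<exists>j\<in>J - {l}. \<bar>V j \<omega>\<bar> > share * fst q)}"

abbreviation sums_exceedance :: "real \<times> real \<Rightarrow> 'a set" where
  "sums_exceedance \<equiv> exceedance M (\<lambda>\<omega>. \<Sum>k\<in>I. U k \<omega>) (\<lambda>\<omega>. \<Sum>l\<in>J. V l \<omega>)"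

lemma share_pos: "0 < share"
  and share_le_1: "share \<le> 1"
  and card_I_share: "real (card I) * share \<le> 1"
  and card_J_share: "real (card J) * share \<le> 1"
  by (simp_all add: share_def divide_le_eq)

lemma disturbed_eq_UN:
  "disturbed k l q =
    (\<Union>i\<in>I - {k}. {\<omega>\<in>exceedance M (U k) (V l) (share *\<^sub>R snd q). \<bar>U i \<omega>\<bar> > share * fst q}) \<union>
    (\<Union>j\<in>J - {l}. {\<omega>\<in>exceedance M (U k) (V l) (share *\<^sub>R snd q). \<bar>V j \<omega>\<bar> > share * fst q})"
  by (auto simp: disturbed_def)

lemma disturbed_in_events [measurable]:
  assumes [simp]: "k \<in> I" "l \<in> J"
  shows "disturbed k l q \<in> events"
  unfolding disturbed_eq_UN using finite_I finite_J
  by (intro sets.Un sets.finite_UN) (auto intro!: sets.sets_Collect)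

lemma prob_disturbed_le:
  assumes [simp]: "k \<in> I" "l \<in> J"
  shows "prob (disturbed k l q) \<le>
    (\<Sum>i\<in>I - {k}. joint_abs_tailp M (U i) (U k) (V l) (share *\<^sub>R q)) +
    (\<Sum>j\<in>J - {l}. joint_abs_tailp M (V j) (U k) (V l) (share *\<^sub>R q))"
proof -
  let ?large = "\<lambda>Z. {\<omega>\<in>exceedance M (U k) (V l) (share *\<^sub>R snd q). \<bar>Z \<omega>\<bar> > share * fst q}"
  have "prob (disturbed k l q) \<le> prob (\<Union>i\<in>I - {k}. ?large (U i)) + prob (\<Union>j\<in>J - {l}. ?large (V j))"
    unfolding disturbed_eq_UN using finite_I finite_J
    by (intro measure_Un_le sets.finite_UN) auto
  also have "\<dots> \<le> (\<Sum>i\<in>I - {k}. prob (?large (U i))) + (\<Sum>j\<in>J - {l}. prob (?large (V j)))"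
    using finite_I finite_J by (intro add_mono measure_UNION_le) auto
  finally show ?thesis
    by (simp add: joint_abs_tailp_def)
qed

lemma prob_disturbed_smallo:
  assumes indices: "k \<in> I" "l \<in> J"
    and U_negl: "\<And>i. i \<in> I - {k} \<Longrightarrow> tail_negligible M (U i) (U k) (V l)"
    and V_negl: "\<And>j. j \<in> J - {l} \<Longrightarrow> tail_negligible M (V j) (U k) (V l)"
  shows "(\<lambda>q. prob (disturbed k l q))
    \<in> o[at_top \<times>\<^sub>F at_top \<times>\<^sub>F at_top](\<lambda>q. joint_tailp M (U k) (V l) (snd q))"
proof -
  let ?bound = "\<lambda>q. (\<Sum>i\<in>I - {k}. joint_abs_tailp M (U i) (U k) (V l) (share *\<^sub>R q)) +
    (\<Sum>j\<in>J - {l}. joint_abs_tailp M (V j) (U k) (V l) (share *\<^sub>R q))"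
  have "(\<lambda>q. prob (disturbed k l q)) \<in> O[at_top \<times>\<^sub>F at_top \<times>\<^sub>F at_top](?bound)"
    using prob_disturbed_le[OF indices]
    by (intro bigoI[of _ 1] always_eventually allI) (auto intro: order.trans[OF _ abs_ge_self])
  also have "?bound \<in> o[at_top \<times>\<^sub>F at_top \<times>\<^sub>F at_top](\<lambda>q. joint_tailp M (U k) (V l) (snd q))"
    using U_negl V_negl share_pos
    by (intro sum_in_smallo big_sum_in_smallo) (simp_all add: tail_negligible_def)
  finally show ?thesis .
qed

lemma sums_exceedance_subset:
  assumes "0 \<le> a" "0 \<le> p"
  shows "sums_exceedance p \<subseteq>
    (\<Union>(k, l)\<in>I \<times> J. exceedance M (U k) (V l) (p - (a, a)) \<union> disturbed k l (a, p))"
proof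
  fix \<omega> assume "\<omega> \<in> sums_exceedance p"
  then have \<omega>: "\<omega> \<in> space M" "fst p < (\<Sum>k\<in>I. U k \<omega>)" "snd p < (\<Sum>l\<in>J. V l \<omega>)"
    by (auto simp: exceedance_def split_def)
  have p_nonneg: "0 \<le> fst p" "0 \<le> snd p"
    using assms(2) by (simp_all add: less_eq_prod_def)
  obtain k where "k \<in> I" "share * fst p < U k \<omega>"
    "fst p - a < U k \<omega> \<or> (\<exists>i\<in>I - {k}. share * a < \<bar>U i \<omega>\<bar>)"
    using sum_gt_imp_large_term[OF finite_I less_imp_le[OF share_pos] card_I_share p_nonneg(1)
        assms(1) \<omega>(2)] by blast
  moreover obtain l where "l \<in> J" "share * snd p < V l \<omega>"
    "snd p - a < V l \<omega> \<or> (\<exists>j\<in>J - {l}. share * a < \<bar>V j \<omega>\<bar>)"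
    using sum_gt_imp_large_term[OF finite_J less_imp_le[OF share_pos] card_J_share p_nonneg(2)
        assms(1) \<omega>(3)] by blast
  ultimately have "(k, l) \<in> I \<times> J"
    and "\<omega> \<in> exceedance M (U k) (V l) (p - (a, a)) \<union> disturbed k l (a, p)"
    using \<omega>(1) by (auto simp: exceedance_def disturbed_def split_def)
  then show "\<omega> \<in> (\<Union>(k, l)\<in>I \<times> J. exceedance M (U k) (V l) (p - (a, a)) \<union> disturbed k l (a, p))"
    by blast
qed

definition undisturbed :: "real \<Rightarrow> real \<times> real \<Rightarrow> 'i \<times> 'j \<Rightarrow> 'a set" where
  "undisturbed a p = (\<lambda>(k, l). exceedance M (U k) (V l) (p + (a, a)) - disturbed k l (a, p))"

lemma share_mult_le_plus:
  assumes "0 \<le> z" "0 \<le> a"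
  shows "share * z \<le> z + a" and "share * a \<le> z + a"
  using assms mult_right_mono[OF share_le_1, of z] mult_right_mono[OF share_le_1, of a] by auto

lemma undisturbedD:
  assumes \<omega>: "\<omega> \<in> undisturbed a p (k, l)" and a_nonneg: "0 \<le> a" and p_nonneg: "0 \<le> p"
  shows "\<omega> \<in> space M" "fst p + a < U k \<omega>" "snd p + a < V l \<omega>"
    and "\<And>i. i \<in> I - {k} \<Longrightarrow> \<bar>U i \<omega>\<bar> \<le> share * a" "\<And>j. j \<in> J - {l} \<Longrightarrow> \<bar>V j \<omega>\<bar> \<le> share * a"
proof -
  show "\<omega> \<in> space M" "fst p + a < U k \<omega>" "snd p + a < V l \<omega>"
    using \<omega> by (auto simp: undisturbed_def exceedance_def split_def)
  then have "\<omega> \<in> exceedance M (U k) (V l) (share *\<^sub>R p)"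
    using share_mult_le_plus(1)[of "fst p" a] share_mult_le_plus(1)[of "snd p" a] a_nonneg p_nonneg
    by (auto simp: exceedance_def split_def less_eq_prod_def)
  then show "\<And>i. i \<in> I - {k} \<Longrightarrow> \<bar>U i \<omega>\<bar> \<le> share * a" "\<And>j. j \<in> J - {l} \<Longrightarrow> \<bar>V j \<omega>\<bar> \<le> share * a"
    using \<omega> by (auto simp: undisturbed_def disturbed_def not_less)
qed

lemma undisturbed_subset_sums_exceedance:
  assumes "0 \<le> a" "0 \<le> p" "k \<in> I" "l \<in> J"
  shows "undisturbed a p (k, l) \<subseteq> sums_exceedance p"
proof
  fix \<omega> assume "\<omega> \<in> undisturbed a p (k, l)"
  note \<omega> = undisturbedD[OF this assms(1,2)]
  have "fst p < (\<Sum>k\<in>I. U k \<omega>)"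
    using \<omega>(2,4) share_pos card_I_share assms
    by (intro large_term_imp_sum_gt[OF finite_I, of share a k]) auto
  moreover have "snd p < (\<Sum>l\<in>J. V l \<omega>)"
    using \<omega>(3,5) share_pos card_J_share assms
    by (intro large_term_imp_sum_gt[OF finite_J, of share a l]) auto
  ultimately show "\<omega> \<in> sums_exceedance p"
    using \<omega>(1) by (simp add: exceedance_def split_def)
qed

lemma disjoint_undisturbed:
  assumes a_nonneg: "0 \<le> a" and p_nonneg: "0 \<le> p"
  shows "disjoint_family_on (undisturbed a p) (I \<times> J)"
proof -
  have "kl = kl'" if "kl \<in> I \<times> J" "kl' \<in> I \<times> J" "\<omega> \<in> undisturbed a p kl" "\<omega> \<in> undisturbed a p kl'"
    for kl kl' \<omega>
  proof -
    obtain k l k' l' where pairs_eq: "kl = (k, l)" "kl' = (k', l')"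
      by fastforce
    note \<omega> = undisturbedD[OF that(3)[unfolded pairs_eq(1)] a_nonneg p_nonneg]
      and \<omega>' = undisturbedD[OF that(4)[unfolded pairs_eq(2)] a_nonneg p_nonneg]
    have "k' = k"
      using \<omega>(4)[of k'] \<omega>'(2) share_mult_le_plus(2)[of "fst p" a] that(2) a_nonneg p_nonneg
      by (auto simp: pairs_eq less_eq_prod_def abs_le_iff)
    moreover have "l' = l"
      using \<omega>(5)[of l'] \<omega>'(3) share_mult_le_plus(2)[of "snd p" a] that(2) a_nonneg p_nonneg
      by (auto simp: pairs_eq less_eq_prod_def abs_le_iff)
    ultimately show ?thesis
      by (simp add: pairs_eq)
  qed
  then show ?thesis
    unfolding disjoint_family_on_def by blast
qed

lemma prob_sums_exceedance_le:
  assumes "0 \<le> a" "0 \<le> p"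
  shows "prob (sums_exceedance p) \<le>
    (\<Sum>k\<in>I. \<Sum>l\<in>J. joint_tailp M (U k) (V l) (p - (a, a)) + prob (disturbed k l (a, p)))"
proof -
  let ?A = "\<lambda>(k, l). exceedance M (U k) (V l) (p - (a, a)) \<union> disturbed k l (a, p)"
  have A_events: "?A kl \<in> events" if "kl \<in> I \<times> J" for kl
    using that by (auto intro!: sets.Un disturbed_in_events)
  have "prob (sums_exceedance p) \<le> prob (\<Union>kl\<in>I \<times> J. ?A kl)"
    using sums_exceedance_subset[OF assms] A_events finite_I finite_J
    by (intro finite_measure_mono sets.finite_UN) auto
  also have "\<dots> \<le> (\<Sum>kl\<in>I \<times> J. prob (?A kl))"
    using A_events finite_I finite_J by (intro measure_UNION_le) auto
  also have "\<dots> \<le>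
      (\<Sum>(k, l)\<in>I \<times> J. joint_tailp M (U k) (V l) (p - (a, a)) + prob (disturbed k l (a, p)))"
    using disturbed_in_events by (intro sum_mono) (auto simp: joint_tailp_def intro!: measure_Un_le)
  finally show ?thesis
    by (simp add: sum.cartesian_product)
qed

lemma prob_sums_exceedance_ge:
  assumes "0 \<le> a" "0 \<le> p"
  shows "(\<Sum>k\<in>I. \<Sum>l\<in>J. joint_tailp M (U k) (V l) (p + (a, a)) - prob (disturbed k l (a, p)))
    \<le> prob (sums_exceedance p)"
proof -
  have events: "undisturbed a p kl \<in> events" if "kl \<in> I \<times> J" for kl
    using that by (auto simp: undisturbed_def intro!: sets.Diff disturbed_in_events)
  have "joint_tailp M (U k) (V l) (p + (a, a)) - prob (disturbed k l (a, p))
      \<le> prob (undisturbed a p (k, l))" if "k \<in> I" "l \<in> J" for k l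
  proof -
    have "joint_tailp M (U k) (V l) (p + (a, a))
        \<le> prob (undisturbed a p (k, l) \<union> disturbed k l (a, p))"
      using that events disturbed_in_events unfolding joint_tailp_def
      by (intro finite_measure_mono) (auto simp: undisturbed_def)
    also have "\<dots> \<le> prob (undisturbed a p (k, l)) + prob (disturbed k l (a, p))"
      using that events disturbed_in_events by (intro measure_Un_le) auto
    finally show ?thesis by simp
  qed
  then have "(\<Sum>k\<in>I. \<Sum>l\<in>J. joint_tailp M (U k) (V l) (p + (a, a)) - prob (disturbed k l (a, p)))
      \<le> (\<Sum>k\<in>I. \<Sum>l\<in>J. prob (undisturbed a p (k, l)))"
    by (intro sum_mono) auto
  also have "\<dots> = (\<Sum>kl\<in>I \<times> J. prob (undisturbed a p kl))"
    by (simp add: sum.cartesian_product)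
  also have "\<dots> = prob (\<Union>kl\<in>I \<times> J. undisturbed a p kl)"
    using finite_I finite_J events disjoint_undisturbed[OF assms]
    by (intro finite_measure_finite_Union[symmetric]) auto
  also have "\<dots> \<le> prob (sums_exceedance p)"
    using undisturbed_subset_sums_exceedance[OF assms] by (intro finite_measure_mono) auto
  finally show ?thesis .
qed

lemma ex_eventually_prob_disturbed_le:
  assumes U_negl: "\<And>k l i. k \<in> I \<Longrightarrow> l \<in> J \<Longrightarrow> i \<in> I - {k} \<Longrightarrow> tail_negligible M (U i) (U k) (V l)"
    and V_negl: "\<And>k l j. k \<in> I \<Longrightarrow> l \<in> J \<Longrightarrow> j \<in> J - {l} \<Longrightarrow> tail_negligible M (V j) (U k) (V l)"
    and e_pos: "0 < e"
  shows "\<exists>a>0. \<forall>\<^sub>F p in at_top \<times>\<^sub>F at_top. \<forall>k\<in>I. \<forall>l\<in>J.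
    prob (disturbed k l (a, p)) \<le> e * joint_tailp M (U k) (V l) p"
proof -
  have "\<forall>\<^sub>F q in at_top \<times>\<^sub>F at_top \<times>\<^sub>F at_top. \<forall>k\<in>I. \<forall>l\<in>J.
      prob (disturbed k l q) \<le> e * joint_tailp M (U k) (V l) (snd q)"
    using landau_o.smallD[OF prob_disturbed_smallo[OF _ _ U_negl V_negl] e_pos]
    by (intro eventually_ball_finite finite_I finite_J ballI) (simp add: joint_tailp_nonneg)
  from eventually_conj[OF eventually_gt_at_top eventually_eventually_prod_filter1[OF this]]
  show ?thesis
    using eventually_happens'[OF trivial_limit_at_top_linorder] by fastforce
qed

lemma prob_sums_exceedance_bounds:
  fixes a h p
  defines "S \<equiv> \<Sum>k\<in>I. \<Sum>l\<in>J. joint_tailp M (U k) (V l) p"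
  assumes nonneg: "0 \<le> a" "0 \<le> p"
    and disturbed: "\<forall>k\<in>I. \<forall>l\<in>J. prob (disturbed k l (a, p)) \<le> h * joint_tailp M (U k) (V l) p"
    and shift_down: "\<forall>k\<in>I. \<forall>l\<in>J.
      joint_tailp M (U k) (V l) (p - (a, a)) \<le> (1 + h) * joint_tailp M (U k) (V l) p"
    and shift_up: "\<forall>k\<in>I. \<forall>l\<in>J.
      (1 - h) * joint_tailp M (U k) (V l) p \<le> joint_tailp M (U k) (V l) (p + (a, a))"
  shows "(1 - 2 * h) * S \<le> prob (sums_exceedance p)"
    and "prob (sums_exceedance p) \<le> (1 + 2 * h) * S"
proof -
  have "(1 - 2 * h) * S \<le>
      (\<Sum>k\<in>I. \<Sum>l\<in>J. joint_tailp M (U k) (V l) (p + (a, a)) - prob (disturbed k l (a, p)))"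
    unfolding S_def sum_distrib_left
    using disturbed shift_up by (intro sum_mono) (force simp: algebra_simps)
  also have "\<dots> \<le> prob (sums_exceedance p)"
    by (rule prob_sums_exceedance_ge[OF nonneg])
  finally show "(1 - 2 * h) * S \<le> prob (sums_exceedance p)" .
  have "prob (sums_exceedance p) \<le>
      (\<Sum>k\<in>I. \<Sum>l\<in>J. joint_tailp M (U k) (V l) (p - (a, a)) + prob (disturbed k l (a, p)))"
    by (rule prob_sums_exceedance_le[OF nonneg])
  also have "\<dots> \<le> (1 + 2 * h) * S"
    unfolding S_def sum_distrib_left
    using disturbed shift_down by (intro sum_mono) (force simp: algebra_simps)
  finally show "prob (sums_exceedance p) \<le> (1 + 2 * h) * S" .
qed

theorem joint_tailp_sums_asymp_equiv:
  assumes long_tailed: "\<And>k l. k \<in> I \<Longrightarrow> l \<in> J \<Longrightarrow> joint_classL (joint_tailp M (U k) (V l))"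
    and U_negl: "\<And>k l i. k \<in> I \<Longrightarrow> l \<in> J \<Longrightarrow> i \<in> I - {k} \<Longrightarrow> tail_negligible M (U i) (U k) (V l)"
    and V_negl: "\<And>k l j. k \<in> I \<Longrightarrow> l \<in> J \<Longrightarrow> j \<in> J - {l} \<Longrightarrow> tail_negligible M (V j) (U k) (V l)"
  shows "joint_tailp M (\<lambda>\<omega>. \<Sum>k\<in>I. U k \<omega>) (\<lambda>\<omega>. \<Sum>l\<in>J. V l \<omega>)
    \<sim>[at_top \<times>\<^sub>F at_top] (\<lambda>p. \<Sum>k\<in>I. \<Sum>l\<in>J. joint_tailp M (U k) (V l) p)"
    (is "?sums \<sim>[_] ?S")
proof -
  have "\<forall>\<^sub>F p in at_top \<times>\<^sub>F at_top. (1 - e) * ?S p \<le> ?sums p \<and> ?sums p \<le> (1 + e) * ?S p"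
    if "0 < e" for e
  proof -
    have half_pos: "0 < e / 2" (is "0 < ?h") using that by simp
    obtain a where a_pos: "0 < a"
      and disturbed: "\<forall>\<^sub>F p in at_top \<times>\<^sub>F at_top. \<forall>k\<in>I. \<forall>l\<in>J.
        prob (disturbed k l (a, p)) \<le> ?h * joint_tailp M (U k) (V l) p"
      using ex_eventually_prob_disturbed_le[OF U_negl V_negl half_pos] by blast
    note bounds =
      joint_classL_imp_eventually_bounds[OF long_tailed joint_tailp_nonneg a_pos half_pos]
    have shift_down: "\<forall>\<^sub>F p in at_top \<times>\<^sub>F at_top. \<forall>k\<in>I. \<forall>l\<in>J.
        joint_tailp M (U k) (V l) (p - (a, a)) \<le> (1 + ?h) * joint_tailp M (U k) (V l) p"
      by (intro eventually_ball_finite finite_I finite_J ballI bounds(1))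
    have shift_up: "\<forall>\<^sub>F p in at_top \<times>\<^sub>F at_top. \<forall>k\<in>I. \<forall>l\<in>J.
        (1 - ?h) * joint_tailp M (U k) (V l) p \<le> joint_tailp M (U k) (V l) (p + (a, a))"
      by (intro eventually_ball_finite finite_I finite_J ballI bounds(2))
    show ?thesis
      using disturbed shift_down shift_up eventually_ge_prod_at_top[of 0]
    proof eventually_elim
      case (elim p)
      from prob_sums_exceedance_bounds[OF less_imp_le[OF a_pos] elim(4,1,2,3)] show ?case
        by (simp add: joint_tailp_def[of M "\<lambda>\<omega>. \<Sum>k\<in>I. U k \<omega>"])
    qed
  qed
  then show ?thesis
    by (simp add: asymp_equiv_iff_eventually_bounds sum_nonneg joint_tailp_nonneg)
qed

end

subsection \<open>Sums with bounded independent weights\<close>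

context prob_space
begin

theorem weighted_sums_joint_tailp_asymp_equiv:
  fixes X Th :: "'i \<Rightarrow> 'a \<Rightarrow> real" and Y De :: "'j \<Rightarrow> 'a \<Rightarrow> real"
  assumes I: "finite I" "I \<noteq> {}" and J: "finite J" "J \<noteq> {}"
    and pair: "\<And>k l. k \<in> I \<Longrightarrow> l \<in> J \<Longrightarrow> weighted_pair M (X k) (Y l) (Th k) (De l) b"
    and X_negl: "\<And>k l i. k \<in> I \<Longrightarrow> l \<in> J \<Longrightarrow> i \<in> I - {k} \<Longrightarrow> tail_negligible M (X i) (X k) (Y l)"
    and Y_negl: "\<And>k l j. k \<in> I \<Longrightarrow> l \<in> J \<Longrightarrow> j \<in> J - {l} \<Longrightarrow> tail_negligible M (Y j) (X k) (Y l)"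
  shows "joint_tailp M (\<lambda>\<omega>. \<Sum>k\<in>I. Th k \<omega> * X k \<omega>) (\<lambda>\<omega>. \<Sum>l\<in>J. De l \<omega> * Y l \<omega>)
    \<sim>[at_top \<times>\<^sub>F at_top]
    (\<lambda>p. \<Sum>k\<in>I. \<Sum>l\<in>J. joint_tailp M (\<lambda>\<omega>. Th k \<omega> * X k \<omega>) (\<lambda>\<omega>. De l \<omega> * Y l \<omega>) p)"
proof -
  obtain k0 l0 where indices0: "k0 \<in> I" "l0 \<in> J"
    using I(2) J(2) by blast
  have X_Th: "X k \<in> borel_measurable M" "Th k \<in> borel_measurable M"
      "AE \<omega> in M. \<bar>Th k \<omega>\<bar> \<le> b" if "k \<in> I" for k
    using weighted_pair.X[OF pair[OF that indices0(2)]]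
      weighted_pair.Th[OF pair[OF that indices0(2)]]
      weighted_pair.AE_abs_weights_le(1)[OF pair[OF that indices0(2)]] by auto
  have Y_De: "Y l \<in> borel_measurable M" "De l \<in> borel_measurable M"
      "AE \<omega> in M. \<bar>De l \<omega>\<bar> \<le> b" if "l \<in> J" for l
    using weighted_pair.Y[OF pair[OF indices0(1) that]]
      weighted_pair.De[OF pair[OF indices0(1) that]]
      weighted_pair.AE_abs_weights_le(2)[OF pair[OF indices0(1) that]] by auto
  interpret two_random_sums M I J "\<lambda>k \<omega>. Th k \<omega> * X k \<omega>" "\<lambda>l \<omega>. De l \<omega> * Y l \<omega>"
    using I J X_Th Y_De by unfold_locales (auto intro: borel_measurable_times)
  show ?thesis
  proof (rule joint_tailp_sums_asymp_equiv)
    fix k l assume indices: "k \<in> I" "l \<in> J"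
    interpret weighted_pair M "X k" "Y l" "Th k" "De l" b
      by (rule pair[OF indices])
    show "joint_classL weighted_tailp"
      by (rule joint_classL_weighted_tailp)
    show "tail_negligible M (\<lambda>\<omega>. Th i \<omega> * X i \<omega>) (\<lambda>\<omega>. Th k \<omega> * X k \<omega>) (\<lambda>\<omega>. De l \<omega> * Y l \<omega>)"
      if "i \<in> I - {k}" for i
      using that X_Th X_negl[OF indices that] by (intro tail_negligible_weighted) auto
    show "tail_negligible M (\<lambda>\<omega>. De j \<omega> * Y j \<omega>) (\<lambda>\<omega>. Th k \<omega> * X k \<omega>) (\<lambda>\<omega>. De l \<omega> * Y l \<omega>)"
      if "j \<in> J - {l}" for j
      using that Y_De Y_negl[OF indices that] by (intro tail_negligible_weighted) auto
  qed
qed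

lemma eventually_AE_le_if_bounded:
  fixes W :: "'i \<Rightarrow> 'a \<Rightarrow> real"
  assumes "finite I" and [measurable]: "\<And>i. i \<in> I \<Longrightarrow> W i \<in> borel_measurable M"
    and bounded: "\<And>i. i \<in> I \<Longrightarrow> \<exists>b. prob {\<omega>\<in>space M. W i \<omega> \<le> b} = 1"
  shows "\<forall>\<^sub>F b in at_top. \<forall>i\<in>I. AE \<omega> in M. W i \<omega> \<le> b"
proof (intro eventually_ball_finite assms(1) ballI)
  fix i assume i_in_I: "i \<in> I"
  then obtain b0 where "prob {\<omega>\<in>space M. W i \<omega> \<le> b0} = 1"
    using bounded by blast
  then have "AE \<omega> in M. W i \<omega> \<le> b0"
    using i_in_I by (simp add: prob_Collect_eq_1)
  then have "AE \<omega> in M. W i \<omega> \<le> b" if "b0 \<le> b" for b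
    by eventually_elim (use that in simp)
  with eventually_ge_at_top[of b0] show "\<forall>\<^sub>F b in at_top. AE \<omega> in M. W i \<omega> \<le> b"
    by (rule eventually_mono)
qed

lemma GTAI_imp_tail_negligible:
  assumes gtai: "GTAI M n m X Y" and indices: "k \<in> {1..n}" "l \<in> {1..m}"
    and meas: "X k \<in> borel_measurable M" "Y l \<in> borel_measurable M"
    and joint_D: "joint_classD (joint_tailp M (X k) (Y l))"
  shows "\<And>i. i \<in> {1..n} - {k} \<Longrightarrow> tail_negligible M (X i) (X k) (Y l)"
    and "\<And>j. j \<in> {1..m} - {l} \<Longrightarrow> tail_negligible M (Y j) (X k) (Y l)"
  using gtai indices
  by (auto simp: GTAI_def intro!: cprob_tendsto_0_imp_tail_negligible[OF meas joint_D])

lemma indep_var_restrict_pair_components: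
  fixes A X :: "'i \<Rightarrow> 'a \<Rightarrow> 'b" and B Y :: "'j \<Rightarrow> 'a \<Rightarrow> 'c"
  assumes "indep_var (PiM I S \<Otimes>\<^sub>M PiM J T) (\<lambda>\<omega>. (restrict (\<lambda>i. A i \<omega>) I, restrict (\<lambda>j. B j \<omega>) J))
      (PiM I S \<Otimes>\<^sub>M PiM J T) (\<lambda>\<omega>. (restrict (\<lambda>i. X i \<omega>) I, restrict (\<lambda>j. Y j \<omega>) J))"
    and indices: "k \<in> I" "l \<in> J"
  shows "indep_var (S k \<Otimes>\<^sub>M T l) (\<lambda>\<omega>. (A k \<omega>, B l \<omega>)) (S k \<Otimes>\<^sub>M T l) (\<lambda>\<omega>. (X k \<omega>, Y l \<omega>))"
proof -
  have components: "(\<lambda>p. (fst p k, snd p l)) \<in> measurable (PiM I S \<Otimes>\<^sub>M PiM J T) (S k \<Otimes>\<^sub>M T l)"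
    using indices by measurable
  from indep_var_compose[OF assms(1) components components] indices show ?thesis
    by (simp add: comp_def)
qed

end

theorem theorem2p1:
  fixes M :: "'a measure" and n m :: nat
    and X Th :: "nat \<Rightarrow> 'a \<Rightarrow> real" and Y De :: "nat \<Rightarrow> 'a \<Rightarrow> real"
    and C :: "nat \<Rightarrow> real"
  assumes P: "prob_space M"
    and nm: "n \<ge> 1" "m \<ge> 1"
    and rvX: "\<And>i. i \<in> {1..n} \<Longrightarrow> X i \<in> borel_measurable M"
    and rvY: "\<And>j. j \<in> {1..m} \<Longrightarrow> Y j \<in> borel_measurable M"
    and rvTh: "\<And>i. i \<in> {1..n} \<Longrightarrow> Th i \<in> borel_measurable M"
    and rvDe: "\<And>j. j \<in> {1..m} \<Longrightarrow> De j \<in> borel_measurable M"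
    \<comment> \<open>(A1)\<close>
    and gtai: "GTAI M n m X Y"
    and Th_nonneg: "\<And>i. i \<in> {1..n} \<Longrightarrow> \<forall>\<omega>\<in>space M. Th i \<omega> \<ge> 0"
    and De_nonneg: "\<And>j. j \<in> {1..m} \<Longrightarrow> \<forall>\<omega>\<in>space M. De j \<omega> \<ge> 0"
    and Th_nondeg: "\<And>i. i \<in> {1..n} \<Longrightarrow> measure M {\<omega>\<in>space M. Th i \<omega> = 0} < 1"
    and De_nondeg: "\<And>j. j \<in> {1..m} \<Longrightarrow> measure M {\<omega>\<in>space M. De j \<omega> = 0} < 1"
    and Th_bdd: "\<And>i. i \<in> {1..n} \<Longrightarrow> \<exists>b. measure M {\<omega>\<in>space M. Th i \<omega> \<le> b} = 1"
    and De_bdd: "\<And>j. j \<in> {1..m} \<Longrightarrow> \<exists>b. measure M {\<omega>\<in>space M. De j \<omega> \<le> b} = 1"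
    and indep: "prob_space.indep_var M
        (PiM {1..n} (\<lambda>_. borel) \<Otimes>\<^sub>M PiM {1..m} (\<lambda>_. borel))
        (\<lambda>\<omega>. (restrict (\<lambda>i. Th i \<omega>) {1..n}, restrict (\<lambda>j. De j \<omega>) {1..m}))
        (PiM {1..n} (\<lambda>_. borel) \<Otimes>\<^sub>M PiM {1..m} (\<lambda>_. borel))
        (\<lambda>\<omega>. (restrict (\<lambda>i. X i \<omega>) {1..n}, restrict (\<lambda>j. Y j \<omega>) {1..m}))"
    \<comment> \<open>(A2)\<close>
    and FD: "\<And>i. i \<in> {1..n} \<Longrightarrow> classD (tailp M (X i)) \<and> classL (tailp M (X i))"
    and GD: "\<And>j. j \<in> {1..m} \<Longrightarrow> classD (tailp M (Y j)) \<and> classL (tailp M (Y j))"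
    and sai: "\<And>i. i \<in> {1..min n m} \<Longrightarrow> SAI M (X i) (Y i) (C i)"
    and indXY: "\<And>i j. i \<in> {1..n} \<Longrightarrow> j \<in> {1..m} \<Longrightarrow> i \<noteq> j \<Longrightarrow>
        prob_space.indep_var M borel (X i) borel (Y j)"
  shows "(\<lambda>(x, y). measure M {\<omega>\<in>space M.
            (\<Sum>i=1..n. Th i \<omega> * X i \<omega>) > x \<and> (\<Sum>j=1..m. De j \<omega> * Y j \<omega>) > y})
         \<sim>[(at_top \<times>\<^sub>F at_top)]
         (\<lambda>(x, y). \<Sum>i=1..n. \<Sum>j=1..m.
            measure M {\<omega>\<in>space M. Th i \<omega> * X i \<omega> > x \<and> De j \<omega> * Y j \<omega> > y})"
proof -
  interpret prob_space M by (rule P)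
  have "\<forall>\<^sub>F b in at_top. 0 < b \<and> (\<forall>i\<in>{1..n}. AE \<omega> in M. Th i \<omega> \<le> b) \<and>
      (\<forall>j\<in>{1..m}. AE \<omega> in M. De j \<omega> \<le> b)"
    by (intro eventually_conj eventually_gt_at_top eventually_AE_le_if_bounded
        finite_atLeastAtMost rvTh rvDe Th_bdd De_bdd)
  then obtain b where b_bounds: "0 < b" "\<forall>i\<in>{1..n}. AE \<omega> in M. Th i \<omega> \<le> b"
    "\<forall>j\<in>{1..m}. AE \<omega> in M. De j \<omega> \<le> b"
    using eventually_happens'[OF trivial_limit_at_top_linorder] by blast
  have SAI_or_indep: "SAI M (X k) (Y l) (C k) \<or> indep_var borel (X k) borel (Y l)"
    if "k \<in> {1..n}" "l \<in> {1..m}" for k l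
    using that sai[of k] indXY[of k l] by (cases "k = l") auto
  have joint_D_L: "joint_classD (joint_tailp M (X k) (Y l))"
    "joint_classL (joint_tailp M (X k) (Y l))"
    if indices: "k \<in> {1..n}" "l \<in> {1..m}" for k l
    using joint_class_if_SAI_or_indep_var[OF rvX rvY _ _ _ _ _ _ SAI_or_indep] FD GD gtai indices
    by (auto simp: GTAI_def)
  have "weighted_pair M (X k) (Y l) (Th k) (De l) b" if "k \<in> {1..n}" "l \<in> {1..m}" for k l
    by unfold_locales (use that b_bounds rvX rvY rvTh rvDe Th_nonneg De_nonneg joint_D_L
        indep_var_restrict_pair_components[OF indep that] in auto)
  then show ?thesis
    using weighted_sums_joint_tailp_asymp_equiv[of "{1..n}" "{1..m}" X Y Th De b] nm
      GTAI_imp_tail_negligible[OF gtai _ _ rvX rvY joint_D_L(1)]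
    by (simp add: joint_tailp_def[abs_def] exceedance_def split_def)
qed

end
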